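(* Let $d \ge 2$ be a fixed integer and consider the random complex process $\{Y_d(n,m)\}_m$. Let $$M_1 = \min\{ m \mid Y_d(n,m) \text{ has no isolated } (d-1)\text{-dimensional faces}\},$$ and let $$M_2 = \min\{ m \mid H^{d-1}(Y_d(n,m),\mathbb{Q}) = 0\}.$$ Then with high probability $M_1 = M_2$.
   Context: The process $\{Y_d(n,m)\}_{0\le m\le\binom{n}{d+1}}$ starts from $Y_d(n,0)$, the complete $(d-1)$-skeleton of the simplex on vertex set $[n]=\{1,\dots,n\}$; $d$-dimensional faces are then added one at a time, each chosen uniformly at random from all $d$-faces (i.e. $(d+1)$-subsets of $[n]$) not already chosen, and $Y_d(n,m)$ is the complex after $m$ faces have been added. A $(d-1)$-face is isolated if it is not contained in any $d$-face of the complex. "With high probability" means with probability tending to $1$ as $n\to\infty$. *)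

theory Defs
  imports "HOL-Probability.Probability" "HOL-Algebra.Elementary_Groups"
begin

section \<open>Simplicial cohomology with rational coefficients\<close>

text \<open>
  An abstract simplicial complex is given by its set of nonempty faces.
\<close>

definition dim_faces :: "'v set set \<Rightarrow> nat \<Rightarrow> 'v set set" where
  "dim_faces X k = {s \<in> X. finite s \<and> card s = k + 1}"

text \<open>
  The vertices are linearly ordered, and each face carries the orientation given by that order.
  Hence a \<open>k\<close>-cochain is a function on the \<open>k\<close>-faces, here extended by \<open>0\<close> to all sets.
\<close>

definition cochains :: "nat \<Rightarrow> 'v set set \<Rightarrow> ('v set \<Rightarrow> rat) set" where
  "cochains k X = {f. \<forall>s. s \<notin> dim_faces X k \<longrightarrow> f s = 0}"

text \<open>
  If \<open>s\<close> has vertices \<open>v\<^sub>0 < \<dots> < v\<^sub>k\<^sub>+\<^sub>1\<close>, then the exponent belonging to \<open>v\<^sub>j\<close> is \<open>j\<close>.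
\<close>

definition coboundary :: "nat \<Rightarrow> 'v::linorder set set \<Rightarrow> ('v set \<Rightarrow> rat) \<Rightarrow> 'v set \<Rightarrow> rat" where
  "coboundary k X f s =
     (if s \<in> dim_faces X (k + 1)
      then \<Sum>v\<in>s. (-1) ^ card {w \<in> s. w < v} * f (s - {v})
      else 0)"

definition cocycles :: "nat \<Rightarrow> 'v::linorder set set \<Rightarrow> ('v set \<Rightarrow> rat) set" where
  "cocycles k X = {f \<in> cochains k X. coboundary k X f = (\<lambda>_. 0)}"

primrec coboundaries :: "nat \<Rightarrow> 'v::linorder set set \<Rightarrow> ('v set \<Rightarrow> rat) set" where
  "coboundaries 0 X = {\<lambda>_. 0}"
| "coboundaries (Suc k) X = coboundary k X ` cochains k X"

definition cocycle_group :: "nat \<Rightarrow> 'v::linorder set set \<Rightarrow> ('v set \<Rightarrow> rat) monoid" where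
  "cocycle_group k X = \<lparr>carrier = cocycles k X, mult = (\<lambda>f g s. f s + g s), one = (\<lambda>_. 0)\<rparr>"

definition cohomology :: "nat \<Rightarrow> 'v::linorder set set \<Rightarrow> ('v set \<Rightarrow> rat) set monoid" where
  "cohomology k X = cocycle_group k X Mod coboundaries k X"


section \<open>The random complex process\<close>

definition all_faces :: "nat \<Rightarrow> nat \<Rightarrow> nat set set" where
  "all_faces d n = {s. s \<subseteq> {1..n} \<and> card s = d + 1}"

text \<open>The list records the \<open>d\<close>-faces in the order in which they are added.\<close>

primrec random_faces :: "nat \<Rightarrow> nat \<Rightarrow> nat \<Rightarrow> nat set list pmf" where
  "random_faces d n 0 = return_pmf []"
| "random_faces d n (Suc m) =
     bind_pmf (random_faces d n m) (\<lambda>fs.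
       map_pmf (\<lambda>s. fs @ [s]) (pmf_of_set (all_faces d n - set fs)))"

text \<open>
  All \<open>n choose (d + 1)\<close> faces are added, so that a sample \<open>fs\<close> determines the whole trajectory
  \<open>Y d n fs 0, Y d n fs 1, \<dots>\<close>.
\<close>

definition face_process :: "nat \<Rightarrow> nat \<Rightarrow> nat set list pmf" where
  "face_process d n = random_faces d n (n choose (d + 1))"

definition Y :: "nat \<Rightarrow> nat \<Rightarrow> nat set list \<Rightarrow> nat \<Rightarrow> nat set set" where
  "Y d n fs m = {s. s \<noteq> {} \<and> s \<subseteq> {1..n} \<and> card s \<le> d} \<union> set (take m fs)"

definition isolated :: "'v set set \<Rightarrow> nat \<Rightarrow> 'v set \<Rightarrow> bool" where
  "isolated X k s \<longleftrightarrow> s \<in> dim_faces X k \<and> \<not> (\<exists>t \<in> dim_faces X (k + 1). s \<subseteq> t)"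

text \<open>
  Both minima exist whenever \<open>n > d\<close>; for the finitely many other \<open>n\<close> the value may be unspecified.
\<close>

definition M1 :: "nat \<Rightarrow> nat \<Rightarrow> nat set list \<Rightarrow> nat" where
  "M1 d n fs =
     (LEAST m. m \<le> n choose (d + 1) \<and> \<not> (\<exists>s. isolated (Y d n fs m) (d - 1) s))"

definition M2 :: "nat \<Rightarrow> nat \<Rightarrow> nat set list \<Rightarrow> nat" where
  "M2 d n fs =
     (LEAST m. m \<le> n choose (d + 1) \<and> trivial_group (cohomology (d - 1) (Y d n fs m)))"

end

theory Submission
  imports Defs "HOL-Real_Asymp.Real_Asymp"
begin

text \<open>
  An isolated \<open>(d - 1)\<close>-face carries a cocycle that is not a coboundary, so cohomology cannot vanish
  before the last isolated face has been covered. The content of the theorem is that nothing else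
  delays its vanishing, and it is enough to prove this with coefficients in the field with two
  elements: a rational cocycle that is not a coboundary can be normalised so that it vanishes on
  all faces through the vertex 1, scaled to integer values that are not all even, and reduced
  modulo 2 (\<open>rational_cohomology_vanishes\<close>). A cochain modulo 2 is a set of \<open>d\<close>-subsets of \<open>[n]\<close>.

  Let \<open>T = n choose (d + 1)\<close> and stop the process at time \<open>m\<close>, about
  \<open>(d - 1/16) T ln n / n\<close>, shortly before the last isolated face is covered. Take a cocycle modulo 2
  of the complex at time \<open>m\<close>, of least size in its cohomology class, and split it into connected
  components, two faces being adjacent if they lie in a common \<open>d\<close>-face. Every component is again a
  cocycle of least size. A component with one element is an isolated face. A component \<open>C\<close> with more
  elements is called a cluster; being of least size, it has a coboundary of at least
  \<open>n |C| / (d + 1)\<close> faces (\<open>coboundary_expansion\<close>, the coboundary expansion of the simplex found by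
  Meshulam and Wallach), none of which has been drawn. If no cluster is a cocycle at time \<open>m\<close>, then
  cohomology at any later time is generated by faces isolated at time \<open>m\<close>. Two adjacent isolated
  faces would themselves form a cluster that is a cocycle, so these faces are pairwise non-adjacent,
  and each \<open>d\<close>-face that covers one of them removes it from every cocycle. Hence cohomology vanishes as soon as no
  isolated face is left (\<open>mod2_cohomology_vanishes\<close>), provided that this has not happened before
  time \<open>m\<close>, which the second moment method excludes with high probability (\<open>no_isolated_prob\<close>).

  It remains to bound the expected number of clusters that are cocycles at time \<open>m\<close>
  (\<open>cluster_sum_bound\<close>). A fixed cluster \<open>C\<close> survives with probability at most \<open>n\<close> to the power
  \<open>- (d - 1/16) |cob C| / n\<close>, where \<open>|cob C|\<close> is the size of its coboundary. If the elements of \<open>C\<close> had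
  few common cofaces, then \<open>|cob C|\<close> would be close to \<open>n |C|\<close>, and this would beat the number of
  connected sets, about \<open>n\<close> to the power \<open>d + |C| - 1\<close>. If they have many, then few elements
  \<open>S\<close> of \<open>C\<close> are adjacent to most of \<open>C\<close> (\<open>greedy_cover\<close>): a set \<open>S\<close> of at most \<open>16 d |C| / n\<close> elements
  can be chosen such that the \<open>u\<close> elements of \<open>C\<close> not adjacent to \<open>S\<close> still force \<open>|cob C|\<close> to be at
  least \<open>n u\<close>, up to a small multiple of \<open>n |C|\<close> (\<open>cob_lower_bound\<close>). To specify \<open>S\<close> and the part of
  \<open>C\<close> adjacent to \<open>S\<close> costs only a bounded factor per element of \<open>C\<close>, and each of the remaining \<open>u\<close>
  elements costs a factor of order \<open>n\<close>, because \<open>C\<close> is connected (\<open>rooted_cover_weight\<close>). The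
  probability outweighs this: \<open>d - 1/16\<close> exceeds 1, and expansion bounds the surplus in the
  exponent below by a multiple of \<open>|C|\<close> (\<open>cluster_exponent\<close>).
\<close>


section \<open>Cochains modulo 2\<close>

definition ksets :: "nat \<Rightarrow> nat \<Rightarrow> nat set set" where
  "ksets n k = {s. s \<subseteq> {1..n} \<and> card s = k}"

text \<open>
  A cochain modulo 2 is identified with its support, a set of faces. Addition is then symmetric
  difference, and the coboundary is a parity count.
\<close>

definition cob :: "nat \<Rightarrow> nat \<Rightarrow> nat set set \<Rightarrow> nat set set" where
  "cob n k A = {s \<in> ksets n (Suc k). odd (card {v\<in>s. s - {v} \<in> A})}"

text \<open>
  The coboundary of the full simplex. Values are taken in any ring, because the integral version is
  also used to derive the rules modulo 2.
\<close>

definition signed_sum :: "(nat set \<Rightarrow> 'a) \<Rightarrow> nat set \<Rightarrow> 'a::comm_ring_1" where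
  "signed_sum f s = (\<Sum>v\<in>s. (-1) ^ card {w\<in>s. w < v} * f (s - {v}))"

lemma ksets_finite [simp]: "finite (ksets n k)"
  unfolding ksets_def by (rule finite_subset[of _ "Pow {1..n}"]) auto

lemma finite_if_in_ksets: "s \<in> ksets n k \<Longrightarrow> finite s"
  unfolding ksets_def by (auto intro: finite_subset)

lemma card_ksets: "card (ksets n k) = n choose k"
  unfolding ksets_def using n_subsets[of "{1..n}" k] by simp

lemma ksets_remove: "s \<in> ksets n (Suc k) \<Longrightarrow> v \<in> s \<Longrightarrow> s - {v} \<in> ksets n k"
  unfolding ksets_def by (auto simp: card_Diff_singleton)

lemma ksets_insert: "s \<in> ksets n k \<Longrightarrow> v \<in> {1..n} \<Longrightarrow> v \<notin> s \<Longrightarrow> insert v s \<in> ksets n (Suc k)"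
  unfolding ksets_def by (auto simp: finite_subset[of s "{1..n}"])

lemma cob_subset: "cob n k A \<subseteq> ksets n (Suc k)"
  unfolding cob_def by auto

text \<open>
  Removing \<open>v\<close> and then \<open>w\<close> leads to the same set as removing \<open>w\<close> and then \<open>v\<close>, with the opposite sign.
  Hence the double sum equals its own negative.
\<close>

lemma signed_sum_signed_sum:
  fixes f :: "nat set \<Rightarrow> 'a::linordered_idom"
  assumes "finite s"
  shows "signed_sum (signed_sum f) s = 0"
proof -
  define r where "r v = card {w\<in>s. w < v}" for v
  define g where "g v w = (-1) ^ (r v + card {u\<in>s - {v}. u < w}) * f (s - {v} - {w})" for v w
  have anti: "g v w = - g w v" if "v \<in> s" "w \<in> s" "v < w" for v w
  proof -
    have *: "{u\<in>s. u < w} = insert v {u\<in>s - {v}. u < w}" using that by auto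
    have "r w = Suc (card {u\<in>s - {v}. u < w})"
      unfolding r_def * using assms by (subst card_insert_disjoint) auto
    moreover have "{u\<in>s - {w}. u < v} = {u\<in>s. u < v}" using that by auto
    hence "card {u\<in>s - {w}. u < v} = r v" by (simp add: r_def)
    moreover have "s - {v} - {w} = s - {w} - {v}" by auto
    ultimately show ?thesis unfolding g_def by (simp add: add.commute)
  qed
  have anti': "g v w = - g w v" if "v \<in> s" "w \<in> s" "v \<noteq> w" for v w
    using anti[of v w] anti[of w v] that by (cases "v < w") auto
  define S where "S = (\<Sum>v\<in>s. \<Sum>w\<in>s. if w = v then 0 else g v w)"
  have "S = (\<Sum>w\<in>s. \<Sum>v\<in>s. if w = v then 0 else g v w)"
    unfolding S_def by (rule sum.swap)
  also have "\<dots> = (\<Sum>w\<in>s. \<Sum>v\<in>s. - (if v = w then 0 else g w v))"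
  proof (intro sum.cong refl)
    fix w v assume "w \<in> s" "v \<in> s"
    thus "(if w = v then 0 else g v w) = - (if v = w then 0 else g w v)"
      using anti'[of v w] by (cases "v = w") simp_all
  qed
  also have "\<dots> = - S" unfolding S_def by (simp only: sum_negf)
  finally have "S = 0" by simp
  moreover have "signed_sum (signed_sum f) s = S"
  proof -
    have "(\<Sum>w\<in>s - {v}. g v w) = (\<Sum>w\<in>s. if w = v then 0 else g v w)" if "v \<in> s" for v
      using assms that by (subst sum.remove[of s v]) (auto intro!: sum.cong)
    thus ?thesis unfolding signed_sum_def S_def g_def r_def
      by (auto simp: sum_distrib_left power_add mult.assoc intro!: sum.cong)
  qed
  ultimately show ?thesis by simp
qed

text \<open>
  Signs are invisible modulo 2. This carries the rule that the coboundary squares to zero from the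
  integers to sets of faces.
\<close>

lemma odd_signed_sum_iff:
  fixes f :: "nat set \<Rightarrow> int"
  assumes "finite s"
  shows "odd (signed_sum f s) \<longleftrightarrow> odd (card {v\<in>s. odd (f (s - {v}))})"
  unfolding signed_sum_def using assms by (simp add: even_sum_iff)

lemma cob_cob: "cob n (Suc k) (cob n k B) = {}"
proof -
  have "even (card {v\<in>s. s - {v} \<in> cob n k B})" if s: "s \<in> ksets n (Suc (Suc k))" for s
  proof -
    define f :: "nat set \<Rightarrow> int" where "f t = of_bool (t \<in> B)" for t
    have fin: "finite s" using s by (rule finite_if_in_ksets)
    have "s - {v} \<in> cob n k B \<longleftrightarrow> odd (signed_sum f (s - {v}))" if "v \<in> s" for v
      using ksets_remove[OF s that] fin
      by (subst odd_signed_sum_iff) (auto simp: cob_def f_def)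
    hence "{v\<in>s. s - {v} \<in> cob n k B} = {v\<in>s. odd (signed_sum f (s - {v}))}" by auto
    thus ?thesis using odd_signed_sum_iff[OF fin, of "signed_sum f"] signed_sum_signed_sum[OF fin, of f]
      by simp
  qed
  thus ?thesis by (auto simp: cob_def)
qed

lemma odd_card_sym_diff:
  assumes "finite P" "finite Q"
  shows "odd (card (sym_diff P Q)) \<longleftrightarrow> odd (card P) \<noteq> odd (card Q)"
proof -
  have "card (sym_diff P Q) = card (P - Q) + card (Q - P)"
    using assms by (intro card_Un_disjoint) auto
  moreover have "card P = card (P - Q) + card (P \<inter> Q)"
    using assms by (metis card_Diff_subset_Int card_mono finite_Int inf_le1 le_add_diff_inverse2)
  moreover have "card Q = card (Q - P) + card (P \<inter> Q)"
    using assms by (metis card_Diff_subset_Int card_mono finite_Int inf_le1 le_add_diff_inverse2 inf_commute)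
  ultimately show ?thesis by presburger
qed

lemma cob_sym_diff: "cob n k (sym_diff A B) = sym_diff (cob n k A) (cob n k B)"
proof -
  have "odd (card {v\<in>s. s - {v} \<in> sym_diff A B}) \<longleftrightarrow>
     odd (card {v\<in>s. s - {v} \<in> A}) \<noteq> odd (card {v\<in>s. s - {v} \<in> B})" if "s \<in> ksets n (Suc k)" for s
  proof -
    have fin: "finite s" using that by (rule finite_if_in_ksets)
    have "{v\<in>s. s - {v} \<in> sym_diff A B} = sym_diff {v\<in>s. s - {v} \<in> A} {v\<in>s. s - {v} \<in> B}" by auto
    thus ?thesis using odd_card_sym_diff[of "{v\<in>s. s - {v} \<in> A}" "{v\<in>s. s - {v} \<in> B}"] fin by simp
  qed
  thus ?thesis unfolding cob_def by blast
qed

definition cone_link :: "nat \<Rightarrow> nat set set \<Rightarrow> nat set set" where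
  "cone_link x A = {t. x \<notin> t \<and> insert x t \<in> A}"

text \<open>
  Coning from the vertex \<open>x\<close> contracts the simplex. Accordingly, adding the coboundary of the link of
  \<open>x\<close> to \<open>A\<close> leaves no face through \<open>x\<close>, and it leaves a face \<open>s\<close> avoiding \<open>x\<close> exactly if the cone
  \<open>insert x s\<close> belongs to the coboundary of \<open>A\<close>.
\<close>

lemma card_sym_diff_cone:
  assumes A: "A \<subseteq> ksets n (Suc k)" and x: "x \<in> {1..n}"
  shows "card (sym_diff A (cob n k (cone_link x A))) = card {s \<in> cob n (Suc k) A. x \<in> s}"
proof -
  let ?A' = "sym_diff A (cob n k (cone_link x A))"
  have A'sub: "?A' \<subseteq> ksets n (Suc k)" using A cob_subset by blast
  have not_x: "x \<notin> s" if s: "s \<in> ?A'" for s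
  proof
    assume xs: "x \<in> s"
    have "{v\<in>s. s - {v} \<in> cone_link x A} = (if s \<in> A then {x} else {})"
      using xs by (auto simp: cone_link_def insert_absorb)
    hence "s \<in> cob n k (cone_link x A) \<longleftrightarrow> s \<in> A" using s A'sub by (auto simp: cob_def)
    thus False using s by auto
  qed
  have iff: "insert x s \<in> cob n (Suc k) A \<longleftrightarrow> s \<in> ?A'" if s: "s \<in> ksets n (Suc k)" and xs: "x \<notin> s" for s
  proof -
    have fin: "finite s" using s by (rule finite_if_in_ksets)
    have 1: "{v\<in>s. s - {v} \<in> cone_link x A} = {v\<in>s. insert x (s - {v}) \<in> A}"
      using xs by (auto simp: cone_link_def)
    have "{v\<in>insert x s. insert x s - {v} \<in> A} = {v. v = x \<and> s \<in> A} \<union> {v\<in>s. insert x (s - {v}) \<in> A}"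
      using xs by (auto simp: insert_Diff_if)
    moreover have "card \<dots> = card {v. v = x \<and> s \<in> A} + card {v\<in>s. insert x (s - {v}) \<in> A}"
      using fin xs by (intro card_Un_disjoint) auto
    moreover have "card {v. v = x \<and> s \<in> A} = of_bool (s \<in> A)" by auto
    ultimately have "odd (card {v\<in>insert x s. insert x s - {v} \<in> A}) \<longleftrightarrow> (s \<in> A) \<noteq> (s \<in> cob n k (cone_link x A))"
      using 1 s by (auto simp: cob_def)
    thus ?thesis using ksets_insert[OF s x xs] by (auto simp: cob_def)
  qed
  have "bij_betw (insert x) ?A' {s \<in> cob n (Suc k) A. x \<in> s}"
  proof (rule bij_betw_imageI)
    show "inj_on (insert x) ?A'" 
    proof (rule inj_onI)
      fix s t assume "s \<in> ?A'" "t \<in> ?A'" "insert x s = insert x t"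
      thus "s = t" using not_x[of s] not_x[of t] insert_ident[of x s t] by simp
    qed
    show "insert x ` ?A' = {s \<in> cob n (Suc k) A. x \<in> s}"
    proof (intro equalityI subsetI)
      fix s assume "s \<in> insert x ` ?A'"
      then obtain t where "t \<in> ?A'" "s = insert x t" by blast
      moreover from this have "t \<in> ksets n (Suc k)" "x \<notin> t" using A'sub not_x by blast+
      ultimately show "s \<in> {s \<in> cob n (Suc k) A. x \<in> s}" using iff[of t] by simp
    next
      fix s assume s: "s \<in> {s \<in> cob n (Suc k) A. x \<in> s}"
      hence "s - {x} \<in> ksets n (Suc k)" using cob_subset ksets_remove by blast
      moreover have "insert x (s - {x}) = s" using s by auto
      ultimately have "s - {x} \<in> ?A'" using iff[of "s - {x}"] s by auto
      thus "s \<in> insert x ` ?A'" using \<open>insert x (s - {x}) = s\<close> by (metis imageI)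
    qed
  qed
  thus ?thesis by (rule bij_betw_same_card)
qed

text \<open>
  Each of the \<open>n\<close> cones yields a cochain cohomologous to \<open>A\<close>, hence one at least as large as \<open>A\<close>. Summing
  their sizes over all vertices counts every face of the coboundary once for each of its \<open>k + 2\<close> vertices.
\<close>

lemma coboundary_expansion:
  assumes A: "A \<subseteq> ksets n (Suc k)"
    and minim: "\<And>B. card A \<le> card (sym_diff A (cob n k B))"
  shows "n * card A \<le> (k + 2) * card (cob n (Suc k) A)"
proof -
  have fin: "finite (cob n (Suc k) A)" by (rule finite_subset[OF cob_subset ksets_finite])
  have "n * card A = (\<Sum>x\<in>{1..n}. card A)" by simp
  also have "\<dots> \<le> (\<Sum>x\<in>{1..n}. card {s \<in> cob n (Suc k) A. x \<in> s})"
    using minim card_sym_diff_cone[OF A] by (intro sum_mono) metis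
  also have "\<dots> = (\<Sum>s\<in>cob n (Suc k) A. card {x\<in>{1..n}. x \<in> s})"
    using fin by (intro sum_multicount_gen) auto
  also have "\<dots> = (\<Sum>s\<in>cob n (Suc k) A. k + 2)"
  proof (intro sum.cong refl)
    fix s assume "s \<in> cob n (Suc k) A"
    hence "s \<in> ksets n (k + 2)" using cob_subset by fastforce
    hence "{x\<in>{1..n}. x \<in> s} = s" "card s = k + 2" by (auto simp: ksets_def)
    thus "card {x\<in>{1..n}. x \<in> s} = k + 2" by simp
  qed
  finally show ?thesis by (simp add: mult.commute)
qed

section \<open>Clusters and cohomology modulo 2\<close>

text \<open>
  Meant for sets of equal size, where it says that both are facets of their union.
\<close>

definition adj :: "nat set \<Rightarrow> nat set \<Rightarrow> bool" where
  "adj s t \<longleftrightarrow> s \<noteq> t \<and> card (s \<union> t) = Suc (card s)"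

text \<open>
  Every vertex of \<open>C\<close> can be reached from \<open>W\<close> inside \<open>C\<close>, expressed by cuts instead of paths. For a
  singleton \<open>W\<close> and symmetric \<open>E\<close> this is connectedness of \<open>C\<close>.
\<close>

definition connected_in :: "('a \<Rightarrow> 'a \<Rightarrow> bool) \<Rightarrow> 'a set \<Rightarrow> 'a set \<Rightarrow> bool" where
  "connected_in E W C \<longleftrightarrow> W \<subseteq> C \<and> (\<forall>X. W \<subseteq> X \<longrightarrow> X \<subset> C \<longrightarrow> (\<exists>x\<in>X. \<exists>y\<in>C - X. E x y))"

text \<open>
  These are the properties of a non-trivial component of a smallest cocycle that do not refer to the
  random complex. Such a set is a cocycle of the complex with top faces \<open>F\<close> if its coboundary is
  disjoint from \<open>F\<close>.
\<close>

definition clusters :: "nat \<Rightarrow> nat \<Rightarrow> nat set set set" where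
  "clusters n d = {C. C \<subseteq> ksets n d \<and> 2 \<le> card C \<and> (\<forall>c\<in>C. connected_in adj {c} C)
     \<and> n * card C \<le> (d + 1) * card (cob n d C)}"

lemma facets_adj:
  assumes "s \<in> ksets n (Suc d)" "a \<in> ksets n d" "b \<in> ksets n d" "a \<subseteq> s" "b \<subseteq> s" "a \<noteq> b"
  shows "adj a b \<and> a \<union> b = s"
proof -
  have fin: "finite s" using assms(1) by (rule finite_if_in_ksets)
  have c: "card s = Suc d" "card a = d" "card b = d" using assms by (auto simp: ksets_def)
  have "a \<union> b \<noteq> a"
  proof
    assume "a \<union> b = a"
    hence "b \<subseteq> a" by auto
    thus False using card_subset_eq[of a b] c fin assms finite_subset by metis
  qed
  hence "card a < card (a \<union> b)" using fin assms
    by (intro psubset_card_mono) (auto intro: finite_subset)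
  moreover have "card (a \<union> b) \<le> card s" using fin assms by (intro card_mono) auto
  ultimately have "card (a \<union> b) = Suc d" using c by simp
  moreover from this have "a \<union> b = s" using card_subset_eq[of s "a \<union> b"] c fin assms by auto
  ultimately show ?thesis using c assms by (simp add: adj_def)
qed

lemma adj_sym: 
  assumes "a \<in> ksets n d" "b \<in> ksets n d" "adj a b" shows "adj b a"
  using assms by (auto simp: adj_def ksets_def Un_commute)

lemma facets_card:
  assumes s: "s \<in> ksets n (Suc d)" and A: "A \<subseteq> ksets n d"
  shows "card {v\<in>s. s - {v} \<in> A} = card {a\<in>A. a \<subseteq> s}"
proof -
  have fin: "finite s" using s by (rule finite_if_in_ksets)
  have cs: "card s = Suc d" using s by (simp add: ksets_def)
  have "bij_betw (\<lambda>v. s - {v}) {v\<in>s. s - {v} \<in> A} {a\<in>A. a \<subseteq> s}"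
  proof (rule bij_betw_imageI)
    show "inj_on (\<lambda>v. s - {v}) {v\<in>s. s - {v} \<in> A}" by (rule inj_onI) auto
    show "(\<lambda>v. s - {v}) ` {v\<in>s. s - {v} \<in> A} = {a\<in>A. a \<subseteq> s}"
    proof (intro equalityI subsetI)
      fix a assume a: "a \<in> {a\<in>A. a \<subseteq> s}"
      hence ca: "card a = d" using A by (auto simp: ksets_def)
      hence "card (s - a) = 1" using a cs fin by (subst card_Diff_subset) (auto intro: finite_subset)
      then obtain v where "s - a = {v}" by (auto simp: card_1_singleton_iff)
      hence "v \<in> s" "a = s - {v}" using a by auto
      thus "a \<in> (\<lambda>v. s - {v}) ` {v\<in>s. s - {v} \<in> A}" using a by auto
    qed auto
  qed
  thus ?thesis by (rule bij_betw_same_card)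
qed

lemma cob_iff:
  assumes "A \<subseteq> ksets n d"
  shows "s \<in> cob n d A \<longleftrightarrow> s \<in> ksets n (Suc d) \<and> odd (card {a\<in>A. a \<subseteq> s})"
  using facets_card[OF _ assms] by (auto simp: cob_def)

definition uncovered :: "nat \<Rightarrow> nat \<Rightarrow> nat set set \<Rightarrow> nat set set" where
  "uncovered n d F = {a \<in> ksets n d. \<forall>s\<in>F. \<not> a \<subseteq> s}"

lemma minimal_representative:
  assumes A: "A \<subseteq> ksets n (Suc k)"
  obtains B where "\<And>B'. card (sym_diff A (cob n k B)) \<le> card (sym_diff (sym_diff A (cob n k B)) (cob n k B'))"
proof -
  define B where "B = arg_min (\<lambda>B. card (sym_diff A (cob n k B))) (\<lambda>_. True)"
  have le: "card (sym_diff A (cob n k B)) \<le> card (sym_diff A (cob n k B'))" for B'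
    unfolding B_def by (rule arg_min_nat_le) simp
  have "sym_diff (sym_diff A (cob n k B)) (cob n k B') = sym_diff A (cob n k (sym_diff B B'))" for B'
    unfolding cob_sym_diff by blast
  thus ?thesis using le that by metis
qed

text \<open>
  Among the subsets of \<open>A\<close> that contain \<open>a\<close> and are not adjacent to the rest of \<open>A\<close>, take a smallest one,
  \<open>C\<close>. The facets in \<open>A\<close> of any \<open>s\<close> are pairwise adjacent, so they all lie in \<open>C\<close> or all lie
  outside. Therefore \<open>C\<close> is a cocycle too, and shortening \<open>C\<close> by a coboundary would shorten \<open>A\<close>. Since \<open>a\<close> is
  covered by a face of \<open>F\<close>, it cannot be all of \<open>C\<close>.
\<close>

lemma cocycle_component:
  assumes A: "A \<subseteq> ksets n (Suc k)" and F: "F \<subseteq> ksets n (Suc (Suc k))"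
    and minim: "\<And>B. card A \<le> card (sym_diff A (cob n k B))"
    and coc: "cob n (Suc k) A \<inter> F = {}"
    and a: "a \<in> A" "a \<notin> uncovered n (Suc k) F"
  shows "\<exists>C\<in>clusters n (Suc k). cob n (Suc k) C \<inter> F = {}"
proof -
  have finA: "finite A" using A ksets_finite finite_subset by blast
  (* Unions of components of A. *)
  define closed where "closed X \<longleftrightarrow> X \<subseteq> A \<and> (\<forall>x\<in>X. \<forall>y\<in>A - X. \<not> adj x y)" for X
  define C where "C = arg_min card (\<lambda>X. closed X \<and> a \<in> X)"
  have ex: "closed A \<and> a \<in> A" using a by (simp add: closed_def)
  have C: "closed C" "a \<in> C"
    using arg_min_natI[of "\<lambda>X. closed X \<and> a \<in> X" A card, OF ex] by (auto simp: C_def)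
  have Cmin: "card C \<le> card X" if "closed X" "a \<in> X" for X
    unfolding C_def using that by (intro arg_min_nat_le) simp
  have CA: "C \<subseteq> A" using C by (simp add: closed_def)
  hence CK: "C \<subseteq> ksets n (Suc k)" using A by blast
  have finC: "finite C" using CA finA finite_subset by blast
  have conn: "connected_in adj {c} C" if c: "c \<in> C" for c
    unfolding connected_in_def
  proof (intro conjI allI impI)
    show "{c} \<subseteq> C" using c by simp
    fix X assume X: "{c} \<subseteq> X" "X \<subset> C"
    show "\<exists>x\<in>X. \<exists>y\<in>C - X. adj x y"
    proof (rule ccontr)
      assume no: "\<not> ?thesis"
      have no': "\<not> adj y x" if "x \<in> X" "y \<in> C - X" for x y
        using no that adj_sym[of y n "Suc k" x] X CK by blast
      have 1: "closed X" using C(1) no X unfolding closed_def by blast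
      have 2: "closed (C - X)" using C(1) no' X unfolding closed_def by blast
      have l1: "card X < card C" using X finC psubset_card_mono by blast
      have "C - X \<subset> C" using X by blast
      hence l2: "card (C - X) < card C" using finC psubset_card_mono by blast
      show False
      proof (cases "a \<in> X")
        case True thus False using Cmin[OF 1] l1 by simp
      next
        case False thus False using Cmin[OF 2] C l2 by simp
      qed
    qed
  qed
  have facets: "{b\<in>C. b \<subseteq> s} = {b\<in>A. b \<subseteq> s} \<or> {b\<in>C. b \<subseteq> s} = {}" if s: "s \<in> ksets n (Suc (Suc k))" for s
  proof (rule ccontr)
    assume neg: "\<not> ?thesis"
    then obtain b where b: "b \<in> C" "b \<subseteq> s" by blast
    from neg CA obtain c where c: "c \<in> A - C" "c \<subseteq> s" by blast
    have "adj b c" using facets_adj[OF s, of b c] b c A CA by blast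
    thus False using C(1) b c by (auto simp: closed_def)
  qed
  have coc': "cob n (Suc k) C \<inter> F = {}"
  proof (rule ccontr)
    assume "\<not> ?thesis"
    then obtain s where s: "s \<in> cob n (Suc k) C" "s \<in> F" by blast
    hence "s \<notin> cob n (Suc k) A" using coc by blast
    moreover have sK: "s \<in> ksets n (Suc (Suc k))" using s(2) F by (rule subsetD[rotated])
    ultimately have ev: "even (card {b\<in>A. b \<subseteq> s})" by (simp add: cob_iff[OF A])
    have od: "odd (card {b\<in>C. b \<subseteq> s})" using s(1) by (simp add: cob_iff[OF CK])
    show False using facets[OF sK]
    proof
      assume "{b\<in>C. b \<subseteq> s} = {b\<in>A. b \<subseteq> s}"
      thus False using ev od by simp
    next
      assume "{b\<in>C. b \<subseteq> s} = {}"
      thus False using od by (metis card.empty even_zero)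
    qed
  qed
  have "2 \<le> card C"
  proof (rule ccontr)
    assume "\<not> ?thesis"
    hence "card C \<le> 1" by simp
    hence Ca: "C = {a}" using C(2) card_le_Suc0_iff_eq[OF finC] by auto
    obtain s where s: "s \<in> F" "a \<subseteq> s" using a A by (auto simp: uncovered_def)
    have "{b\<in>C. b \<subseteq> s} = {a}" using Ca s by auto
    hence "s \<in> cob n (Suc k) C" using cob_iff[OF CK, of s] s F by auto
    thus False using coc' s by blast
  qed
  moreover have "n * card C \<le> (k + 2) * card (cob n (Suc k) C)"
  proof (rule coboundary_expansion[OF CK])
    fix B
    let ?D = "cob n k B"
    have finD: "finite ?D" by (rule finite_subset[OF cob_subset ksets_finite])
    have "card A \<le> card (sym_diff A ?D)" by (rule minim)
    also have "\<dots> \<le> card ((A - C) \<union> sym_diff C ?D)"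
      using finA finC finD CA by (intro card_mono) auto
    also have "\<dots> \<le> card (A - C) + card (sym_diff C ?D)" by (rule card_Un_le)
    also have "card (A - C) = card A - card C" using CA finC by (simp add: card_Diff_subset)
    finally show "card C \<le> card (sym_diff C ?D)" using card_mono[OF finA CA] by linarith
  qed
  ultimately have "C \<in> clusters n (Suc k)" using CK conn by (simp add: clusters_def)
  thus ?thesis using coc' by blast
qed

lemma card_cofaces:
  assumes u: "u \<in> ksets n d"
  shows "card {s \<in> ksets n (Suc d). u \<subseteq> s} = n - d"
proof -
  have fu: "finite u" using u by (rule finite_if_in_ksets)
  have "bij_betw (\<lambda>v. insert v u) ({1..n} - u) {s \<in> ksets n (Suc d). u \<subseteq> s}"
  proof (rule bij_betw_imageI)
    show "inj_on (\<lambda>v. insert v u) ({1..n} - u)" by (rule inj_onI) auto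
    show "(\<lambda>v. insert v u) ` ({1..n} - u) = {s \<in> ksets n (Suc d). u \<subseteq> s}"
    proof (intro equalityI subsetI)
      fix s assume s: "s \<in> {s \<in> ksets n (Suc d). u \<subseteq> s}"
      hence "card (s - u) = 1" using u fu by (subst card_Diff_subset) (auto simp: ksets_def)
      then obtain v where "s - u = {v}" by (auto simp: card_1_singleton_iff)
      hence "v \<in> {1..n} - u" "s = insert v u" using s by (auto simp: ksets_def)
      thus "s \<in> (\<lambda>v. insert v u) ` ({1..n} - u)" by blast
    qed (use u ksets_insert in auto)
  qed
  hence "card {s \<in> ksets n (Suc d). u \<subseteq> s} = card ({1..n} - u)" by (metis bij_betw_same_card)
  also have "\<dots> = n - d" using u fu by (subst card_Diff_subset) (auto simp: ksets_def)
  finally show ?thesis .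
qed

text \<open>
  Every \<open>u \<in> U\<close> has \<open>n - d\<close> cofaces. A coface that contains no other element of \<open>C\<close> belongs to the
  coboundary and determines \<open>u\<close>. Any other coface is the union of \<open>u\<close> and an adjacent element \<open>c\<close> of \<open>C\<close>,
  and the number of such pairs \<open>(c, u)\<close> is at most \<open>t\<close> times the size of \<open>C\<close>.
\<close>

lemma cob_lower_bound:
  assumes C: "C \<subseteq> ksets n d" and U: "U \<subseteq> C"
    and t: "\<And>c. c \<in> C \<Longrightarrow> card {u\<in>U. adj c u} \<le> t"
  shows "card U * (n - d) \<le> card (cob n d C) + t * card C"
proof -
  have finC: "finite C" using C ksets_finite finite_subset by blast
  have finU: "finite U" using U finC finite_subset by blast
  define P where "P = (SIGMA u:U. {s \<in> ksets n (Suc d). u \<subseteq> s})"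
  (* Incidences at which u is the only element of C in its coface. *)
  define P1 where "P1 = {p\<in>P. {a\<in>C. a \<subseteq> snd p} = {fst p}}"
  have finP: "finite P" unfolding P_def using finU by auto
  have "card P = (\<Sum>u\<in>U. card {s \<in> ksets n (Suc d). u \<subseteq> s})"
    unfolding P_def using finU by (intro card_SigmaI) auto
  also have "\<dots> = card U * (n - d)" using card_cofaces U C by (simp add: subset_iff)
  finally have cP: "card P = card U * (n - d)" .
  have "card P1 \<le> card (cob n d C)"
  proof (rule card_inj_on_le)
    show "inj_on snd P1"
    proof (rule inj_onI)
      fix p q assume "p \<in> P1" "q \<in> P1" "snd p = snd q"
      hence "{fst p} = {fst q}" unfolding P1_def by auto
      thus "p = q" using \<open>snd p = snd q\<close> by (simp add: prod_eq_iff)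
    qed
    show "snd ` P1 \<subseteq> cob n d C" using cob_iff[OF C] by (auto simp: P1_def P_def)
    show "finite (cob n d C)" by (rule finite_subset[OF cob_subset ksets_finite])
  qed
  moreover have "card (P - P1) \<le> card (SIGMA c:C. {u\<in>U. adj c u})"
  proof (rule card_inj_on_le)
    have *: "\<exists>c\<in>C. adj c u \<and> s = c \<union> u" if "(u, s) \<in> P - P1" for u s
    proof -
      have s: "s \<in> ksets n (Suc d)" "u \<in> U" "u \<subseteq> s" using that by (auto simp: P_def)
      have "{a\<in>C. a \<subseteq> s} \<noteq> {u}" using that by (auto simp: P1_def)
      then obtain c where "c \<in> C" "c \<subseteq> s" "c \<noteq> u" using s U by blast
      thus ?thesis using facets_adj[OF s(1), of c u] s U C by blast
    qed
    define g where "g = (\<lambda>(u, s). (SOME c. c \<in> C \<and> adj c u \<and> s = c \<union> u, u))"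
    have g: "\<exists>c. g (u, s) = (c, u) \<and> c \<in> C \<and> adj c u \<and> s = c \<union> u" if "(u, s) \<in> P - P1" for u s
      using someI_ex[of "\<lambda>c. c \<in> C \<and> adj c u \<and> s = c \<union> u"] *[OF that] by (auto simp: g_def)
    show "inj_on g (P - P1)"
    proof (rule inj_onI)
      fix p q assume pq: "p \<in> P - P1" "q \<in> P - P1" "g p = g q"
      obtain u s v r where "p = (u, s)" "q = (v, r)" by fastforce
      thus "p = q" using g[of u s] g[of v r] pq by auto
    qed
    show "g ` (P - P1) \<subseteq> (SIGMA c:C. {u\<in>U. adj c u})"
    proof
      fix y assume "y \<in> g ` (P - P1)"
      then obtain u s where "(u, s) \<in> P - P1" "y = g (u, s)" by fast
      thus "y \<in> (SIGMA c:C. {u\<in>U. adj c u})" using g[of u s] by (auto simp: P_def)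
    qed
    show "finite (SIGMA c:C. {u\<in>U. adj c u})" using finC finU by auto
  qed
  moreover have "card (SIGMA c:C. {u\<in>U. adj c u}) \<le> t * card C"
  proof -
    have "card (SIGMA c:C. {u\<in>U. adj c u}) = (\<Sum>c\<in>C. card {u\<in>U. adj c u})"
      using finC finU by (intro card_SigmaI) auto
    also have "\<dots> \<le> (\<Sum>c\<in>C. t)" using t by (intro sum_mono) auto
    finally show ?thesis by (simp add: mult.commute)
  qed
  moreover have "card P = card P1 + card (P - P1)"
  proof -
    have "P1 \<subseteq> P" by (auto simp: P1_def)
    thus ?thesis using card_Diff_subset[of P1 P] card_mono[of P P1] finP finite_subset[of P1 P] by simp
  qed
  ultimately show ?thesis using cP by linarith
qed

text \<open>
  Thus the absence of clusters also rules out that two isolated faces lie in a common face.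
\<close>

lemma adjacent_pair_cluster:
  assumes n: "(d + 1)\<^sup>2 \<le> n" and d: "1 \<le> d"
    and ab: "a \<in> ksets n d" "b \<in> ksets n d" "adj a b"
  shows "{a, b} \<in> clusters n d"
proof -
  have ne: "a \<noteq> b" using ab by (simp add: adj_def)
  have conn: "connected_in adj {c} {a, b}" if "c \<in> {a, b}" for c
  proof -
    have "X = {c}" if "{c} \<subseteq> X" "X \<subset> {a, b}" for X using that \<open>c \<in> {a, b}\<close> by auto
    thus ?thesis using ab adj_sym[OF ab] that ne unfolding connected_in_def by fastforce
  qed
  have "card {a, b} * (n - d) \<le> card (cob n d {a, b}) + 1 * card {a, b}"
  proof (rule cob_lower_bound)
    fix c assume "c \<in> {a, b}"
    hence "{u \<in> {a, b}. adj c u} \<subseteq> {if c = a then b else a}" by (auto simp: adj_def)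
    hence "card {u \<in> {a, b}. adj c u} \<le> card {if c = a then b else a}" by (intro card_mono) auto
    thus "card {u \<in> {a, b}. adj c u} \<le> 1" by simp
  qed (use ab in auto)
  hence le: "2 * (n - d) \<le> card (cob n d {a, b}) + 2" using ne by simp
  have dn: "d \<le> n" using n by (auto simp: power2_eq_square)
  have "n * 2 \<le> (d + 1) * (2 * (n - d) - 2)"
  proof -
    have nn: "(d+1)*(d+1) \<le> n" using n by (simp add: power2_eq_square)
    obtain m where m: "n = d + m" using dn le_Suc_ex by blast
    have "d < n" using nn by (simp add: algebra_simps)
    hence "m \<ge> 1" using m by simp
    then obtain p where p: "m = Suc p" by (cases m) auto
    have "(d+1) * p \<ge> d + m"
    proof -
      have "d * p \<ge> d + 1" 
      proof -
        have "p \<ge> d * d + d" using nn m p by (simp add: algebra_simps)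
        moreover have "d * d \<ge> 1 * d" using d by (intro mult_le_mono1)
        ultimately have "p \<ge> d + 1" using d by linarith
        moreover have "d * p \<ge> 1 * p" using d by (intro mult_le_mono1)
        ultimately show ?thesis by linarith
      qed
      thus ?thesis using m p by (simp add: algebra_simps)
    qed
    thus ?thesis using m p by (simp add: algebra_simps)
  qed
  also have "\<dots> \<le> (d + 1) * card (cob n d {a, b})" using le by (intro mult_le_mono2) linarith
  finally show ?thesis using ab ne conn by (simp add: clusters_def)
qed

text \<open>
  By \<open>cocycle_component\<close>, a smallest set \<open>H\<close> cohomologous to \<open>A\<close> consists of faces isolated with respect
  to \<open>F\<close>. A face of \<open>F'\<close> that
  covers one element of \<open>H\<close> must cover a second one, as \<open>H\<close> is a cocycle for \<open>F'\<close>. These two are adjacent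
  and isolated with respect to \<open>F\<close>, so they form a cluster that is a cocycle for \<open>F\<close>.
\<close>

lemma mod2_cohomology_vanishes:
  assumes n: "(k + 2)\<^sup>2 \<le> n"
    and F: "F \<subseteq> F'" "F' \<subseteq> ksets n (Suc (Suc k))"
    and no_cluster: "\<And>C. C \<in> clusters n (Suc k) \<Longrightarrow> cob n (Suc k) C \<inter> F \<noteq> {}"
    and covered: "uncovered n (Suc k) F' = {}"
    and A: "A \<subseteq> ksets n (Suc k)" "cob n (Suc k) A \<inter> F' = {}"
  shows "\<exists>B. A = cob n k B"
proof -
  obtain B where minim: "\<And>B'. card (sym_diff A (cob n k B)) \<le> card (sym_diff (sym_diff A (cob n k B)) (cob n k B'))"
    using minimal_representative[OF A(1)] by blast
  define H where "H = sym_diff A (cob n k B)"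
  have HK: "H \<subseteq> ksets n (Suc k)" using A(1) cob_subset unfolding H_def by blast
  have cobH: "cob n (Suc k) H = cob n (Suc k) A" unfolding H_def cob_sym_diff cob_cob by simp
  have H_unc: "H \<subseteq> uncovered n (Suc k) F"
    using cocycle_component[OF HK, of F] minim F A(2) cobH no_cluster unfolding H_def by blast
  have "H = {}"
  proof (rule ccontr)
    assume "H \<noteq> {}"
    then obtain a where a: "a \<in> H" by blast
    hence "a \<notin> uncovered n (Suc k) F'" using covered by simp
    then obtain s where s: "s \<in> F'" "a \<subseteq> s" using a HK by (auto simp: uncovered_def)
    hence sK: "s \<in> ksets n (Suc (Suc k))" using F by blast
    have finH: "finite H" using HK finite_subset ksets_finite by blast
    have "s \<notin> cob n (Suc k) H" using cobH A(2) s by blast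
    hence "even (card {b\<in>H. b \<subseteq> s})" using cob_iff[OF HK] sK by blast
    hence "{b\<in>H. b \<subseteq> s} \<noteq> {a}" by auto
    then obtain b where b: "b \<in> H" "b \<subseteq> s" "b \<noteq> a" using a s by blast
    have "adj a b" using facets_adj[OF sK, of a b] a b s HK by blast
    hence cl: "{a, b} \<in> clusters n (Suc k)"
      using adjacent_pair_cluster[of "Suc k" n a b] n a b HK by auto
    have "cob n (Suc k) {a, b} \<inter> F = {}"
    proof (rule ccontr)
      assume "\<not> ?thesis"
      then obtain r where r: "r \<in> cob n (Suc k) {a, b}" "r \<in> F" by blast
      hence "odd (card {c\<in>{a, b}. c \<subseteq> r})" using cob_iff[of "{a, b}" n "Suc k" r] a b HK by blast
      hence "{c\<in>{a, b}. c \<subseteq> r} \<noteq> {}" by (metis card.empty even_zero)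
      thus False using H_unc a b r by (auto simp: uncovered_def)
    qed
    thus False using no_cluster[OF cl] by blast
  qed
  hence "A = cob n k B" unfolding H_def by blast
  thus ?thesis by blast
qed

section \<open>Passing to rational coefficients\<close>

lemma signed_sum_add: "signed_sum (\<lambda>s. f s + g s) s = signed_sum f s + signed_sum g s"
  unfolding signed_sum_def by (simp add: distrib_left sum.distrib)

lemma signed_sum_cmult: "signed_sum (\<lambda>s. c * f s) s = c * signed_sum f s"
  unfolding signed_sum_def by (simp add: sum_distrib_left mult.left_commute)

lemma signed_sum_cong:
  "(\<And>v. v \<in> s \<Longrightarrow> f (s - {v}) = g (s - {v})) \<Longrightarrow> signed_sum f s = signed_sum g s"
  unfolding signed_sum_def by (auto intro!: sum.cong)

definition skel :: "nat \<Rightarrow> nat \<Rightarrow> nat set set \<Rightarrow> nat set set" where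
  "skel d n F = {s. s \<noteq> {} \<and> s \<subseteq> {1..n} \<and> card s \<le> d} \<union> F"

lemma Y_skel: "Y d n fs m = skel d n (set (take m fs))"
  by (simp add: Y_def skel_def)

lemma dim_faces_skel_low:
  assumes "F \<subseteq> ksets n (Suc d)" "Suc j \<le> d"
  shows "dim_faces (skel d n F) j = ksets n (Suc j)"
  using assms by (auto simp: dim_faces_def skel_def ksets_def finite_subset)

lemma dim_faces_skel_top:
  assumes "F \<subseteq> ksets n (Suc d)"
  shows "dim_faces (skel d n F) d = F"
  using assms by (auto simp: dim_faces_def skel_def ksets_def finite_subset)

lemma isolated_skel_iff:
  assumes "F \<subseteq> ksets n (Suc (Suc k))"
  shows "isolated (skel (Suc k) n F) k a \<longleftrightarrow> a \<in> uncovered n (Suc k) F"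
  using dim_faces_skel_top[OF assms] dim_faces_skel_low[OF assms, of k]
  by (auto simp: isolated_def uncovered_def)

lemma common_denominator:
  fixes h :: "'a \<Rightarrow> rat"
  assumes "finite S"
  shows "\<exists>D::int. D \<noteq> 0 \<and> (\<forall>s\<in>S. \<exists>z. of_int D * h s = of_int z)"
  using assms
proof (induction S)
  case empty
  show ?case by (intro exI[of _ 1]) auto
next
  case (insert x S)
  then obtain D :: int where D: "D \<noteq> 0" "\<forall>s\<in>S. \<exists>z. of_int D * h s = of_int z" by blast
  obtain p q :: int where pq: "q > 0" "h x = of_int p / of_int q"
    by (metis Rat_cases Fract_of_int_quotient)
  have "\<exists>z. of_int (q * D) * h s = of_int z" if s: "s \<in> insert x S" for s
  proof (cases "s = x")
    case True
    have "of_int (q * D) * h s = of_int (D * p)" using pq True by simp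
    thus ?thesis by blast
  next
    case False
    then obtain z where "of_int D * h s = of_int z" using D s by blast
    hence "of_int (q * D) * h s = of_int (q * z)" by simp
    thus ?thesis by blast
  qed
  thus ?case using D(1) pq(1) by (intro exI[of _ "q * D"]) auto
qed

text \<open>
  Among the non-zero integral multiples of \<open>h\<close>, one with the smallest sum of absolute values is not divisible
  by 2.
\<close>

lemma integer_multiple_with_odd_value:
  fixes h :: "'a \<Rightarrow> rat"
  assumes fin: "finite {s. h s \<noteq> 0}" and neq: "h \<noteq> (\<lambda>_. 0)"
  shows "\<exists>c z. (\<forall>s. c * h s = of_int (z s)) \<and> (\<exists>s. odd (z s :: int))"
proof -
  define S where "S = {s. h s \<noteq> 0}"
  define weight where "weight z = (\<Sum>s\<in>S. nat \<bar>z s :: int\<bar>)" for z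
  define good where "good z \<longleftrightarrow> (\<exists>c. c \<noteq> 0 \<and> (\<forall>s. c * h s = of_int (z s)))" for z
  obtain D :: int where D: "D \<noteq> 0" "\<forall>s\<in>S. \<exists>z. of_int D * h s = of_int z"
    using common_denominator[of S h] fin by (auto simp: S_def)
  have "\<exists>z. of_int D * h s = of_int z" for s
    using D(2) by (cases "s \<in> S") (auto simp: S_def intro: exI[of _ 0])
  then obtain z0 where "\<And>s. of_int D * h s = of_int (z0 s)" by metis
  hence "good z0" using D(1) unfolding good_def by (intro exI[of _ "of_int D"]) simp
  define z where "z = arg_min weight good"
  have z: "good z" unfolding z_def using arg_min_natI[of good z0 weight] \<open>good z0\<close> by simp
  have zmin: "weight z \<le> weight y" if "good y" for y
    unfolding z_def using that arg_min_nat_le[of good y weight] by simp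
  obtain c where c: "c \<noteq> 0" "\<And>s. c * h s = of_int (z s)" using z unfolding good_def by blast
  have "\<exists>s. odd (z s)"
  proof (rule ccontr)
    assume "\<not> ?thesis"
    hence even: "even (z s)" for s by blast
    have half: "(c / 2) * h s = of_int (z s div 2)" for s
    proof -
      obtain y where y: "z s = 2 * y" using even[of s] by blast
      thus ?thesis using c(2)[of s] by simp
    qed
    hence "good (\<lambda>s. z s div 2)" using c(1) unfolding good_def by (intro exI[of _ "c / 2"]) simp
    moreover have "weight (\<lambda>s. z s div 2) < weight z"
      unfolding weight_def
    proof (rule sum_strict_mono_ex1)
      show "finite S" using fin by (simp add: S_def)
      have lt: "nat \<bar>z s div 2\<bar> < nat \<bar>z s\<bar>" if "s \<in> S" for s
      proof -
        have "z s \<noteq> 0" using c(1) c(2)[of s] that by (auto simp: S_def)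
        moreover obtain y where "z s = 2 * y" using even[of s] by blast
        ultimately show ?thesis by simp
      qed
      thus "\<forall>s\<in>S. nat \<bar>z s div 2\<bar> \<le> nat \<bar>z s\<bar>" by (simp add: less_imp_le)
      show "\<exists>s\<in>S. nat \<bar>z s div 2\<bar> < nat \<bar>z s\<bar>" using neq lt by (auto simp: S_def)
    qed
    ultimately show False using zmin by force
  qed
  thus ?thesis using c(2) by blast
qed

text \<open>
  Here \<open>d = k + 2\<close>, which is where \<open>d \<ge> 2\<close> enters on the algebraic side: the degree \<open>d - 1\<close> is a
  successor, and its coboundaries are images of cochains of degree \<open>k\<close>.
\<close>

locale top_complex =
  fixes n k :: nat and F :: "nat set set"
  assumes F: "F \<subseteq> ksets n (Suc (Suc (Suc k)))"
begin

abbreviation "X \<equiv> skel (Suc (Suc k)) n F"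

lemma coboundary_low: "coboundary k X f s = (if s \<in> ksets n (Suc (Suc k)) then signed_sum f s else 0)"
  using dim_faces_skel_low[OF F, of "Suc k"] by (simp add: coboundary_def signed_sum_def)

lemma coboundary_top: "coboundary (Suc k) X f s = (if s \<in> F then signed_sum f s else 0)"
  using dim_faces_skel_top[OF F] by (simp add: coboundary_def signed_sum_def)

lemma cochains_low: "cochains k X = {f. \<forall>s. s \<notin> ksets n (Suc k) \<longrightarrow> f s = 0}"
  using dim_faces_skel_low[OF F, of k] by (simp add: cochains_def)

lemma cocycles_iff:
  "f \<in> cocycles (Suc k) X \<longleftrightarrow>
     (\<forall>s. s \<notin> ksets n (Suc (Suc k)) \<longrightarrow> f s = 0) \<and> (\<forall>s\<in>F. signed_sum f s = 0)"
  using dim_faces_skel_low[OF F, of "Suc k"]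
  by (auto simp: cocycles_def cochains_def coboundary_top fun_eq_iff)

lemma signed_sum_coboundary:
  assumes "s \<in> ksets n (Suc (Suc (Suc k)))"
  shows "signed_sum (coboundary k X f) s = 0"
proof -
  have "signed_sum (coboundary k X f) s = signed_sum (signed_sum f) s"
    using ksets_remove[OF assms] by (intro signed_sum_cong) (auto simp: coboundary_low)
  thus ?thesis using signed_sum_signed_sum[of s f] finite_if_in_ksets[OF assms] by simp
qed

lemma coboundary_is_cocycle: "coboundary k X f \<in> cocycles (Suc k) X"
  using signed_sum_coboundary F by (auto simp: cocycles_iff coboundary_low)

lemma group_cocycles: "comm_group (cocycle_group (Suc k) X)"
proof (rule comm_groupI)
  let ?G = "cocycle_group (Suc k) X"
  show "x \<otimes>\<^bsub>?G\<^esub> y \<in> carrier ?G" if "x \<in> carrier ?G" "y \<in> carrier ?G" for x y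
    using that by (auto simp: cocycle_group_def cocycles_iff signed_sum_add)
  show "\<one>\<^bsub>?G\<^esub> \<in> carrier ?G"
    by (auto simp: cocycle_group_def cocycles_iff signed_sum_def)
  show "\<exists>y\<in>carrier ?G. y \<otimes>\<^bsub>?G\<^esub> x = \<one>\<^bsub>?G\<^esub>" if "x \<in> carrier ?G" for x
  proof
    show "(\<lambda>s. - 1 * x s) \<in> carrier ?G"
      using that by (simp only: cocycle_group_def cocycles_iff signed_sum_cmult partial_object.simps) simp
    show "(\<lambda>s. - 1 * x s) \<otimes>\<^bsub>?G\<^esub> x = \<one>\<^bsub>?G\<^esub>" by (simp add: cocycle_group_def)
  qed
qed (auto simp: cocycle_group_def add_ac)

lemma subgroup_coboundaries: "subgroup (coboundaries (Suc k) X) (cocycle_group (Suc k) X)"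
proof (rule group.subgroupI)
  let ?G = "cocycle_group (Suc k) X"
  interpret G: comm_group ?G by (rule group_cocycles)
  show "Group.group ?G" by unfold_locales
  show "coboundaries (Suc k) X \<subseteq> carrier ?G"
    using coboundary_is_cocycle by (auto simp: cocycle_group_def)
  show "coboundaries (Suc k) X \<noteq> {}" by (auto simp: cochains_def)
  show "x \<otimes>\<^bsub>?G\<^esub> y \<in> coboundaries (Suc k) X" if "x \<in> coboundaries (Suc k) X" "y \<in> coboundaries (Suc k) X" for x y
  proof -
    obtain f g where fg: "f \<in> cochains k X" "g \<in> cochains k X" "x = coboundary k X f" "y = coboundary k X g"
      using \<open>x \<in> _\<close> \<open>y \<in> _\<close> by auto
    have "(\<lambda>s. f s + g s) \<in> cochains k X" using fg by (auto simp: cochains_def)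
    moreover have "coboundary k X (\<lambda>s. f s + g s) = x \<otimes>\<^bsub>?G\<^esub> y"
      using fg by (auto simp: cocycle_group_def coboundary_low signed_sum_add)
    ultimately show ?thesis by (auto simp: image_iff intro!: bexI[of _ "\<lambda>s. f s + g s"])
  qed
  show "inv\<^bsub>?G\<^esub> x \<in> coboundaries (Suc k) X" if x: "x \<in> coboundaries (Suc k) X" for x
  proof -
    obtain f where f: "f \<in> cochains k X" "x = coboundary k X f" using x by auto
    have c: "(\<lambda>s. - 1 * f s) \<in> cochains k X" using f by (auto simp: cochains_def)
    have "coboundary k X (\<lambda>s. - 1 * f s) s + x s = 0" for s
      unfolding f(2) coboundary_low signed_sum_cmult by simp
    hence "coboundary k X (\<lambda>s. - 1 * f s) \<otimes>\<^bsub>?G\<^esub> x = \<one>\<^bsub>?G\<^esub>"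
      by (simp add: cocycle_group_def)
    moreover have "coboundary k X (\<lambda>s. - 1 * f s) \<in> carrier ?G" "x \<in> carrier ?G"
      using coboundary_is_cocycle f by (auto simp: cocycle_group_def)
    ultimately have "inv\<^bsub>?G\<^esub> x = coboundary k X (\<lambda>s. - 1 * f s)"
      using G.inv_equality by blast
    thus ?thesis using c by auto
  qed
qed

lemma trivial_cohomology_iff:
  "trivial_group (cohomology (Suc k) X) \<longleftrightarrow> cocycles (Suc k) X \<subseteq> coboundaries (Suc k) X"
proof -
  let ?G = "cocycle_group (Suc k) X" and ?B = "coboundaries (Suc k) X"
  interpret G: comm_group ?G by (rule group_cocycles)
  interpret B: subgroup ?B ?G by (rule subgroup_coboundaries)
  have nB: "?B \<lhd> ?G" using G.normal_iff_subgroup B.subgroup_axioms by blast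
  have grp: "Group.group (?G Mod ?B)" using normal.factorgroup_is_group[OF nB] .
  have cG: "carrier ?G = cocycles (Suc k) X" by (simp add: cocycle_group_def)
  have "trivial_group (cohomology (Suc k) X) \<longleftrightarrow> carrier (?G Mod ?B) = {?B}"
    using grp by (simp add: trivial_group_def cohomology_def FactGroup_def)
  also have "\<dots> \<longleftrightarrow> cocycles (Suc k) X \<subseteq> ?B"
  proof
    assume L: "carrier (?G Mod ?B) = {?B}"
    show "cocycles (Suc k) X \<subseteq> ?B"
    proof
      fix x assume x: "x \<in> cocycles (Suc k) X"
      hence "?B #>\<^bsub>?G\<^esub> x \<in> carrier (?G Mod ?B)"
        using cG by (auto simp: FactGroup_def RCOSETS_def)
      hence "?B #>\<^bsub>?G\<^esub> x = ?B" using L by blast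
      moreover have "x \<in> ?B #>\<^bsub>?G\<^esub> x" using G.rcos_self[of x ?B] x cG B.subgroup_axioms by simp
      ultimately show "x \<in> ?B" by simp
    qed
  next
    assume R: "cocycles (Suc k) X \<subseteq> ?B"
    hence "carrier ?G = ?B" using B.subset cG by blast
    hence "?B #>\<^bsub>?G\<^esub> x = ?B" if "x \<in> carrier ?G" for x
      using that G.coset_join2[of x ?B] B.subgroup_axioms by blast
    thus "carrier (?G Mod ?B) = {?B}"
      using G.one_closed unfolding FactGroup_def RCOSETS_def by auto
  qed
  finally show ?thesis .
qed

text \<open>
  The indicator of an isolated face \<open>a\<close> is a cocycle. Were it a coboundary, its signed sum over every
  \<open>insert v a\<close> would vanish, but there the only non-zero term is the one of \<open>a\<close>.
\<close>

lemma trivial_cohomology_imp_covered: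
  assumes triv: "trivial_group (cohomology (Suc k) X)" and n: "n > Suc (Suc k)"
  shows "uncovered n (Suc (Suc k)) F = {}"
proof (rule ccontr)
  assume "\<not> ?thesis"
  then obtain a where a: "a \<in> ksets n (Suc (Suc k))" "\<And>s. s \<in> F \<Longrightarrow> \<not> a \<subseteq> s"
    by (auto simp: uncovered_def)
  define f :: "nat set \<Rightarrow> rat" where "f s = of_bool (s = a)" for s
  have "signed_sum f s = 0" if "s \<in> F" for s
    unfolding signed_sum_def using a(2)[OF that] by (intro sum.neutral) (auto simp: f_def)
  hence "f \<in> cocycles (Suc k) X" using a by (auto simp: cocycles_iff f_def)
  hence "f \<in> coboundaries (Suc k) X" using triv trivial_cohomology_iff by blast
  then obtain g where g: "f = coboundary k X g" by auto
  have "card a < card {1..n}" using a n by (simp add: ksets_def)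
  then obtain v where v: "v \<in> {1..n}" "v \<notin> a"
    using a by (metis (no_types, lifting) ksets_def mem_Collect_eq subsetI subset_antisym less_irrefl)
  have fin: "finite a" using a(1) by (rule finite_if_in_ksets)
  have "signed_sum f (insert v a) = (\<Sum>w\<in>{v}. (-1) ^ card {u\<in>insert v a. u < w} * f (insert v a - {w}))"
    unfolding signed_sum_def using fin v by (intro sum.mono_neutral_right) (auto simp: f_def)
  also have "\<dots> \<noteq> 0" using v by (simp add: f_def)
  finally show False
    using signed_sum_coboundary[OF ksets_insert[OF a(1) v], of g] g by simp
qed

text \<open>
  Subtracting the coboundary of \<open>g\<close>, the link of the vertex 1 in \<open>f\<close>, yields a cocycle \<open>h\<close> that vanishes
  on all faces through 1. Suppose that \<open>h\<close> is not zero. The odd values of a suitable multiple of \<open>h\<close> form a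
  non-empty cocycle \<open>A\<close> modulo 2, and \<open>A\<close> is a coboundary by assumption. So the coboundary of \<open>A\<close> in the full
  simplex is empty; but for \<open>a \<in> A\<close> it contains \<open>insert 1 a\<close>, all of whose other facets pass through 1.
\<close>

lemma rational_cohomology_vanishes:
  assumes mod2: "\<And>A. A \<subseteq> ksets n (Suc (Suc k)) \<Longrightarrow> cob n (Suc (Suc k)) A \<inter> F = {} \<Longrightarrow> \<exists>B. A = cob n (Suc k) B"
    and n: "n \<ge> 1"
  shows "trivial_group (cohomology (Suc k) X)"
  unfolding trivial_cohomology_iff
proof
  fix f assume f: "f \<in> cocycles (Suc k) X"
  define g where "g t = (if t \<in> ksets n (Suc k) \<and> 1 \<notin> t then f (insert 1 t) else 0)" for t
  have gC: "g \<in> cochains k X" by (auto simp: cochains_low g_def)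
  define h where "h s = f s + - 1 * coboundary k X g s" for s
  have h_ss: "signed_sum h s = 0" if "s \<in> F" for s
    unfolding h_def signed_sum_add signed_sum_cmult
    using that f F signed_sum_coboundary[of s g] by (auto simp: cocycles_iff)
  have h_out: "h s = 0" if "s \<notin> ksets n (Suc (Suc k))" for s
    using that f by (simp add: h_def coboundary_low cocycles_iff)
  have h_1: "h s = 0" if s: "1 \<in> s" for s
  proof (cases "s \<in> ksets n (Suc (Suc k))")
    case True
    have fin: "finite s" using True by (rule finite_if_in_ksets)
    have no: "{w \<in> s. w < 1} = {}" using True by (auto simp: ksets_def)
    have "signed_sum g s = (\<Sum>v\<in>{1}. (-1) ^ card {w\<in>s. w < v} * g (s - {v}))"
      unfolding signed_sum_def using fin s by (intro sum.mono_neutral_right) (auto simp: g_def)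
    also have "\<dots> = g (s - {1})" by (subst sum.insert) (simp_all only: no card.empty power_0 finite.emptyI empty_iff not_False_eq_True sum.empty mult_1_left add_0_right)
    also have "\<dots> = f s" using ksets_remove[OF True s] s by (simp add: g_def insert_absorb)
    finally show ?thesis using True by (simp add: h_def coboundary_low)
  qed (rule h_out)
  have "h = (\<lambda>_. 0)"
  proof (rule ccontr)
    assume neq: "h \<noteq> (\<lambda>_. 0)"
    have finsupp: "finite {s. h s \<noteq> 0}"
      by (rule finite_subset[OF _ ksets_finite[of n "Suc (Suc k)"]]) (use h_out in auto)
    obtain c :: rat and z :: "nat set \<Rightarrow> int" where cz: "\<And>s. c * h s = of_int (z s)" "\<exists>s. odd (z s)"
      using integer_multiple_with_odd_value[OF finsupp neq] by blast
    have z_ss: "signed_sum z s = 0" if "s \<in> F" for s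
    proof -
      have "(of_int (signed_sum z s) :: rat) = signed_sum (\<lambda>s. c * h s) s"
        unfolding signed_sum_def cz by simp
      also have "\<dots> = 0" unfolding signed_sum_cmult using h_ss[OF that] by simp
      finally show ?thesis by simp
    qed
    define A where "A = {s. odd (z s)}"
    have zh: "z s = 0" if "h s = 0" for s using cz(1)[of s] that by simp
    have AK: "A \<subseteq> ksets n (Suc (Suc k))"
    proof
      fix s assume "s \<in> A"
      hence "h s \<noteq> 0" using zh[of s] by (auto simp: A_def)
      thus "s \<in> ksets n (Suc (Suc k))" using h_out by blast
    qed
    have A1: "1 \<notin> s" if "s \<in> A" for s
      using that h_1[of s] zh[of s] by (auto simp: A_def)
    have "cob n (Suc (Suc k)) A \<inter> F = {}"
    proof -
      have "s \<notin> cob n (Suc (Suc k)) A" if "s \<in> F" for s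
      proof -
        have "finite s" using that F finite_if_in_ksets by blast
        from odd_signed_sum_iff[OF this, of z] z_ss[OF that] show ?thesis by (simp add: cob_def A_def)
      qed
      thus ?thesis by blast
    qed
    then obtain B where B: "A = cob n (Suc k) B" using mod2[OF AK] by blast
    hence empty: "cob n (Suc (Suc k)) A = {}" using cob_cob by simp
    obtain a where a: "a \<in> A" using cz(2) by (auto simp: A_def)
    have s: "insert 1 a \<in> ksets n (Suc (Suc (Suc k)))"
      using ksets_insert[of a n "Suc (Suc k)" 1] a AK A1 n by auto
    have "{v \<in> insert 1 a. insert 1 a - {v} \<in> A} = {1}"
      using a A1[OF a] A1[of "insert 1 a - {v}" for v] by auto
    hence "insert 1 a \<in> cob n (Suc (Suc k)) A" using s by (simp add: cob_def)
    thus False using empty by simp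
  qed
  hence "f = coboundary k X g" by (simp add: h_def fun_eq_iff)
  thus "f \<in> coboundaries (Suc k) X" using gC by auto
qed

end

section \<open>Counting connected sets by percolation\<close>

lemma sum_Pow_weights:
  fixes a b :: "'a::comm_semiring_1"
  assumes "finite Z"
  shows "(\<Sum>R\<in>Pow Z. a ^ card R * b ^ card (Z - R)) = (a + b) ^ card Z"
  using prod_add[OF assms, of "\<lambda>_. a" "\<lambda>_. b"] by simp

text \<open>
  If each element of \<open>V\<close> is selected independently with probability \<open>\<rho>\<close>, this is the probability that all of
  \<open>A\<close> and none of \<open>B\<close> is selected.
\<close>

lemma sum_weights_between:
  fixes \<rho> :: real
  assumes V: "finite V" and A: "A \<subseteq> V" and B: "B \<subseteq> V" and AB: "A \<inter> B = {}"
  shows "(\<Sum>R\<in>{R. R \<subseteq> V \<and> A \<subseteq> R \<and> R \<inter> B = {}}. \<rho> ^ card R * (1 - \<rho>) ^ card (V - R))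
    = \<rho> ^ card A * (1 - \<rho>) ^ card B"
proof -
  define Z where "Z = V - A - B"
  have fin: "finite A" "finite B" "finite Z" using V A B finite_subset by (auto simp: Z_def)
  have "{R. R \<subseteq> V \<and> A \<subseteq> R \<and> R \<inter> B = {}} = (\<lambda>R. A \<union> R) ` Pow Z"
  proof (intro equalityI subsetI)
    fix R assume R: "R \<in> {R. R \<subseteq> V \<and> A \<subseteq> R \<and> R \<inter> B = {}}"
    hence "R = A \<union> (R - A)" "R - A \<in> Pow Z" unfolding Z_def by blast+
    thus "R \<in> (\<lambda>R. A \<union> R) ` Pow Z" by (rule image_eqI)
  next
    fix R assume "R \<in> (\<lambda>R. A \<union> R) ` Pow Z"
    thus "R \<in> {R. R \<subseteq> V \<and> A \<subseteq> R \<and> R \<inter> B = {}}" using A AB unfolding Z_def by blast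
  qed
  moreover have "inj_on (\<lambda>R. A \<union> R) (Pow Z)"
  proof (rule inj_onI)
    fix R R' assume "R \<in> Pow Z" "R' \<in> Pow Z" "A \<union> R = A \<union> R'"
    moreover have "A \<inter> Z = {}" by (auto simp: Z_def)
    ultimately show "R = R'" by blast
  qed
  ultimately have "(\<Sum>R\<in>{R. R \<subseteq> V \<and> A \<subseteq> R \<and> R \<inter> B = {}}. \<rho> ^ card R * (1 - \<rho>) ^ card (V - R))
      = (\<Sum>R\<in>Pow Z. \<rho> ^ card (A \<union> R) * (1 - \<rho>) ^ card (V - (A \<union> R)))"
    by (simp only: sum.reindex o_def)
  also have "\<dots> = (\<Sum>R\<in>Pow Z. (\<rho> ^ card A * (1 - \<rho>) ^ card B) * (\<rho> ^ card R * (1 - \<rho>) ^ card (Z - R)))"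
  proof (intro sum.cong refl)
    fix R assume R: "R \<in> Pow Z"
    hence finR: "finite R" using fin finite_subset by blast
    have "card (A \<union> R) = card A + card R"
      using R fin finR by (intro card_Un_disjoint) (auto simp: Z_def)
    moreover have "V - (A \<union> R) = B \<union> (Z - R)" using R A B AB by (auto simp: Z_def)
    hence "card (V - (A \<union> R)) = card B + card (Z - R)"
      using R fin by (simp only:) (intro card_Un_disjoint, auto simp: Z_def)
    ultimately show "\<rho> ^ card (A \<union> R) * (1 - \<rho>) ^ card (V - (A \<union> R))
      = (\<rho> ^ card A * (1 - \<rho>) ^ card B) * (\<rho> ^ card R * (1 - \<rho>) ^ card (Z - R))"
      by (simp add: power_add mult_ac)
  qed
  also have "\<dots> = (\<rho> ^ card A * (1 - \<rho>) ^ card B) * (\<Sum>R\<in>Pow Z. \<rho> ^ card R * (1 - \<rho>) ^ card (Z - R))"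
    by (simp add: sum_distrib_left)
  also have "\<dots> = \<rho> ^ card A * (1 - \<rho>) ^ card B" using sum_Pow_weights[OF fin(3), of \<rho> "1 - \<rho>"] by simp
  finally show ?thesis .
qed

text \<open>
  Read \<open>R\<close> as the set of open sites: if all sites of \<open>C1 - W\<close> are open and the outer boundary of \<open>C2\<close> is
  closed, then \<open>C1\<close> cannot leave \<open>C2\<close>. Hence \<open>R\<close> determines the set of sites that \<open>W\<close> reaches.
\<close>

lemma connected_in_subset:
  assumes C1: "connected_in E W C1" "C1 \<subseteq> V" and C2: "W \<subseteq> C2"
    and R: "C1 - W \<subseteq> R" "R \<inter> {y\<in>V - C2. \<exists>x\<in>C2. E x y} = {}"
  shows "C1 \<subseteq> C2"
proof (rule ccontr)
  assume "\<not> C1 \<subseteq> C2"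
  hence "C1 \<inter> C2 \<subset> C1" by blast
  moreover have "W \<subseteq> C1 \<inter> C2" using C1 C2 by (auto simp: connected_in_def)
  ultimately obtain x y where "x \<in> C1 \<inter> C2" "y \<in> C1 - C1 \<inter> C2" "E x y"
    using C1(1) unfolding connected_in_def by meson
  note xy = this
  moreover from xy have "y \<in> R" "y \<in> V" using R(1) C1(2) C2 by auto
  ultimately have "y \<in> R \<inter> {y\<in>V - C2. \<exists>x\<in>C2. E x y}" by auto
  thus False using R(2) by blast
qed

text \<open>
  Open each site outside \<open>W\<close> independently with probability \<open>\<rho>\<close>. For each \<open>C\<close> the summand is at most the
  probability that \<open>C\<close> is the set reached from \<open>W\<close>, as the outer boundary of \<open>C\<close> has at most \<open>\<Delta> |C|\<close>
  sites. These events are disjoint, so their probabilities add up to at most 1.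
\<close>

lemma percolation_bound:
  fixes \<rho> :: real
  assumes V: "finite V" and W: "W \<subseteq> V" and \<rho>: "0 \<le> \<rho>" "\<rho> \<le> 1"
    and deg: "\<And>x. x \<in> V \<Longrightarrow> card {y\<in>V. E x y} \<le> \<Delta>"
  shows "(\<Sum>C\<in>{C. C \<subseteq> V \<and> connected_in E W C}. \<rho> ^ card (C - W) * (1 - \<rho>) ^ (\<Delta> * card C)) \<le> 1"
proof -
  (* Outer boundary, weight of a configuration of open sites, and the event that W reaches exactly C. *)
  define bd where "bd C = {y\<in>V - C. \<exists>x\<in>C. E x y}" for C
  define wt where "wt R = \<rho> ^ card R * (1 - \<rho>) ^ card (V - W - R)" for R
  define ev where "ev C = {R. R \<subseteq> V - W \<and> C - W \<subseteq> R \<and> R \<inter> bd C = {}}" for C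
  let ?K = "{C. C \<subseteq> V \<and> connected_in E W C}"
  have finK: "finite ?K" using V by - (rule finite_subset[of _ "Pow V"], auto)
  have fin_ev: "finite (ev C)" for C
    using V by - (rule finite_subset[of _ "Pow V"], auto simp: ev_def)
  have wt_nonneg: "wt R \<ge> 0" for R using \<rho> by (simp add: wt_def)
  have "\<rho> ^ card (C - W) * (1 - \<rho>) ^ (\<Delta> * card C) \<le> sum wt (ev C)" if C: "C \<in> ?K" for C
  proof -
    have finC: "finite C" using C V finite_subset by blast
    have WC: "W \<subseteq> C" using C by (simp add: connected_in_def)
    have "bd C \<subseteq> (\<Union>x\<in>C. {y\<in>V. E x y})" by (auto simp: bd_def)
    hence "card (bd C) \<le> card (\<Union>x\<in>C. {y\<in>V. E x y})" using V finC by (intro card_mono) auto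
    also have "\<dots> \<le> (\<Sum>x\<in>C. card {y\<in>V. E x y})" using finC by (rule card_UN_le)
    also have "\<dots> \<le> (\<Sum>x\<in>C. \<Delta>)" using C deg by (intro sum_mono) auto
    finally have "card (bd C) \<le> \<Delta> * card C" by (simp add: mult.commute)
    hence "(1 - \<rho>) ^ (\<Delta> * card C) \<le> (1 - \<rho>) ^ card (bd C)" using \<rho> by (intro power_decreasing) auto
    hence "\<rho> ^ card (C - W) * (1 - \<rho>) ^ (\<Delta> * card C) \<le> \<rho> ^ card (C - W) * (1 - \<rho>) ^ card (bd C)"
      using \<rho> by (intro mult_left_mono) auto
    also have "\<dots> = sum wt (ev C)"
      unfolding wt_def ev_def
      by (rule sum_weights_between[symmetric]) (use V C WC in \<open>auto simp: bd_def\<close>)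
    finally show ?thesis .
  qed
  hence "(\<Sum>C\<in>?K. \<rho> ^ card (C - W) * (1 - \<rho>) ^ (\<Delta> * card C)) \<le> (\<Sum>C\<in>?K. sum wt (ev C))"
    by (intro sum_mono) auto
  also have "\<dots> = sum wt (\<Union>C\<in>?K. ev C)"
  proof (rule sum.UNION_disjoint[symmetric])
    show "\<forall>C\<in>?K. \<forall>D\<in>?K. C \<noteq> D \<longrightarrow> ev C \<inter> ev D = {}"
    proof (intro ballI impI)
      fix C D assume CD: "C \<in> ?K" "D \<in> ?K" "C \<noteq> D"
      hence W': "W \<subseteq> C" "W \<subseteq> D" by (auto simp: connected_in_def)
      show "ev C \<inter> ev D = {}"
      proof (rule ccontr)
        assume "ev C \<inter> ev D \<noteq> {}"
        then obtain R where "R \<in> ev C" "R \<in> ev D" by blast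
        hence R: "C - W \<subseteq> R" "R \<inter> bd C = {}" "D - W \<subseteq> R" "R \<inter> bd D = {}"
          unfolding ev_def by simp_all
        have "C \<subseteq> D"
          by (rule connected_in_subset[of E W C V D R]) (use CD W' R in \<open>simp_all add: bd_def\<close>)
        moreover have "D \<subseteq> C"
          by (rule connected_in_subset[of E W D V C R]) (use CD W' R in \<open>simp_all add: bd_def\<close>)
        ultimately show False using CD by simp
      qed
    qed
  qed (use finK fin_ev in auto)
  also have "\<dots> \<le> sum wt (Pow (V - W))"
    using V wt_nonneg by (intro sum_mono2) (auto simp: ev_def)
  also have "\<dots> = 1"
    unfolding wt_def using V sum_Pow_weights[of "V - W" \<rho> "1 - \<rho>"] by simp
  finally show ?thesis .
qed

text \<open>
  The choice \<open>\<rho> = 1 / (2 \<Delta>)\<close> makes a closed boundary cost only a factor 2 per element of \<open>C\<close>, by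
  Bernoulli's inequality. So there are at most about \<open>\<Delta> ^ u\<close> ways to add \<open>u\<close> elements to \<open>W\<close>, up to a
  constant factor for each element of the result.
\<close>

lemma connected_sets_weight:
  assumes V: "finite V" and W: "W \<subseteq> V" and \<Delta>: "\<Delta> \<ge> 1"
    and deg: "\<And>x. x \<in> V \<Longrightarrow> card {y\<in>V. E x y} \<le> \<Delta>"
  shows "(\<Sum>C\<in>{C. C \<subseteq> V \<and> connected_in E W C}. (1 / (2 * real \<Delta>)) ^ card (C - W) * (1 / 2) ^ card C) \<le> 1"
proof -
  define \<rho> where "\<rho> = 1 / (2 * real \<Delta>)"
  have \<rho>: "0 \<le> \<rho>" "\<rho> \<le> 1" using \<Delta> by (auto simp: \<rho>_def field_simps)
  have half: "1 / 2 \<le> (1 - \<rho>) ^ \<Delta>"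
    using Bernoulli_inequality[of "- \<rho>" \<Delta>] \<rho> \<Delta> by (simp add: \<rho>_def)
  have "(\<Sum>C\<in>{C. C \<subseteq> V \<and> connected_in E W C}. \<rho> ^ card (C - W) * (1 / 2) ^ card C)
      \<le> (\<Sum>C\<in>{C. C \<subseteq> V \<and> connected_in E W C}. \<rho> ^ card (C - W) * (1 - \<rho>) ^ (\<Delta> * card C))"
    unfolding power_mult using half \<rho> by (intro sum_mono mult_left_mono power_mono) auto
  also have "\<dots> \<le> 1" by (rule percolation_bound[OF V W \<rho> deg])
  finally show ?thesis unfolding \<rho>_def .
qed

text \<open>
  Take the largest \<open>S\<close> whose members have, on average, covered \<open>t\<close> elements of \<open>C\<close> each. An element with more
  than \<open>t\<close> uncovered neighbours could be added to it.
\<close>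

lemma greedy_cover:
  assumes C: "finite C" and t: "t \<ge> 1"
  obtains S where "S \<subseteq> C" "card S * t \<le> card {c\<in>C. \<exists>s\<in>S. E s c}"
    "\<And>c. c \<in> C \<Longrightarrow> card {u\<in>C - {c\<in>C. \<exists>s\<in>S. E s c}. E c u} \<le> t"
proof -
  define cov where "cov S = {c\<in>C. \<exists>s\<in>S. E s c}" for S
  define good where "good S \<longleftrightarrow> S \<subseteq> C \<and> card S * t \<le> card (cov S)" for S
  have "good {}" by (simp add: good_def)
  moreover have "\<forall>S. good S \<longrightarrow> card S < Suc (card C)"
    using C by (auto simp: good_def less_Suc_eq_le intro: card_mono)
  ultimately have "\<exists>S. good S \<and> (\<forall>S'. good S' \<longrightarrow> card S' \<le> card S)"
    by (rule Lattices_Big.ex_has_greatest_nat[where f = card and P = good])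
  then obtain S where S: "good S" and Smax: "\<And>S'. good S' \<Longrightarrow> card S' \<le> card S"
    by blast
  have "card {u\<in>C - cov S. E c u} \<le> t" if c: "c \<in> C" for c
  proof (rule ccontr)
    assume big: "\<not> ?thesis"
    have finS: "finite S" using S C finite_subset by (auto simp: good_def)
    have "c \<notin> S"
    proof
      assume "c \<in> S"
      hence "{u\<in>C - cov S. E c u} = {}" by (auto simp: cov_def)
      thus False using big by (metis card.empty le0)
    qed
    have "card (insert c S) * t \<le> card (cov S) + card {u\<in>C - cov S. E c u}"
      using S big \<open>c \<notin> S\<close> finS by (simp add: good_def)
    also have "\<dots> = card (cov S \<union> {u\<in>C - cov S. E c u})"
      using C by (intro card_Un_disjoint[symmetric]) (auto simp: cov_def)
    also have "\<dots> \<le> card (cov (insert c S))"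
      using C by (intro card_mono) (auto simp: cov_def)
    finally have "good (insert c S)" using S c by (simp add: good_def)
    hence "card (insert c S) \<le> card S" by (rule Smax)
    thus False using \<open>c \<notin> S\<close> finS by simp
  qed
  thus ?thesis using that[of S] S unfolding good_def cov_def by blast
qed

text \<open>
  A connected set \<open>C\<close> is specified by a root \<open>r\<close>, a subset \<open>S\<close>, the part of \<open>C\<close> adjacent to \<open>S\<close>, and the
  remaining vertices, which are attached by connectedness. The root costs a factor \<open>card V\<close>, and so does
  every element of \<open>S\<close>; the part adjacent to \<open>S\<close> is one of at most \<open>2 ^ (\<Delta> * card S)\<close> sets. The factor 3 bounds
  \<open>(1 + 1 / card V) ^ card V\<close>, the total weight of all choices of \<open>S\<close>.
\<close>

lemma rooted_cover_weight:
  fixes r :: "'a set \<Rightarrow> 'a" and S :: "'a set \<Rightarrow> 'a set"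
  assumes V: "finite V" "V \<noteq> {}" and \<Delta>: "\<Delta> \<ge> 1"
    and deg: "\<And>x. x \<in> V \<Longrightarrow> card {y\<in>V. E x y} \<le> \<Delta>"
    and K: "\<And>C. C \<in> K \<Longrightarrow> C \<subseteq> V \<and> S C \<subseteq> C \<and> r C \<in> C \<and> (\<forall>c\<in>C. connected_in E {c} C)"
    and W: "\<And>C. C \<in> K \<Longrightarrow> W C = insert (r C) {c\<in>C. \<exists>s\<in>S C. E s c}"
  shows "(\<Sum>C\<in>K. (1 / (2 * real \<Delta>)) ^ card (C - W C) * (1 / 2) ^ card C
            * ((1 / 2) ^ (\<Delta> * card (S C)) * (1 / real (card V)) ^ card (S C))) \<le> 3 * real (card V)"
proof -
  define \<Gamma> where "\<Gamma> S = {y\<in>V. \<exists>s\<in>S. E s y}" for S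
  define conn where "conn W = {C. C \<subseteq> V \<and> connected_in E W C}" for W
  define a where "a W C = (1 / (2 * real \<Delta>)) ^ card (C - W) * (1 / 2) ^ card C" for W C :: "'a set"
  define b where "b S = (1 / 2) ^ (\<Delta> * card S) * (1 / real (card V)) ^ card S" for S :: "'a set"
  define I where "I = (SIGMA x:V. SIGMA S:Pow V. SIGMA W:Pow (\<Gamma> S). conn (insert x W))"
  define g where "g = (\<lambda>(x, S, W, C). a (insert x W) C * b S)"
  have fin\<Gamma>: "finite (\<Gamma> S)" for S using V by (simp add: \<Gamma>_def)
  have finconn: "finite (conn W)" for W
    using V by - (rule finite_subset[of _ "Pow V"], auto simp: conn_def)
  have finI: "finite I" unfolding I_def using V fin\<Gamma> finconn by (intro finite_SigmaI) auto
  have nonneg: "a W C \<ge> 0" "b S \<ge> 0" for W C S by (auto simp: a_def b_def)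
  define \<iota> where "\<iota> C = (r C, S C, {c\<in>C. \<exists>s\<in>S C. E s c}, C)" for C
  have "(\<Sum>C\<in>K. a (W C) C * b (S C)) = (\<Sum>C\<in>K. g (\<iota> C))"
    using W by (intro sum.cong) (auto simp: g_def \<iota>_def)
  also have "\<dots> = sum g (\<iota> ` K)"
    by (subst sum.reindex) (auto simp: inj_on_def \<iota>_def)
  also have "\<dots> \<le> sum g I"
  proof (rule sum_mono2[OF finI])
    show "\<iota> ` K \<subseteq> I"
    proof
      fix z assume "z \<in> \<iota> ` K"
      then obtain C where C: "C \<in> K" "z = \<iota> C" by blast
      define W0 where "W0 = {c\<in>C. \<exists>s\<in>S C. E s c}"
      have "connected_in E {r C} C" "C \<subseteq> V" using K[OF C(1)] by auto
      hence "connected_in E (insert (r C) W0) C"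
        using K[OF C(1)] unfolding connected_in_def W0_def by auto
      thus "z \<in> I" using K[OF C(1)] C(2) by (auto simp: I_def \<iota>_def conn_def \<Gamma>_def W0_def)
    qed
    show "0 \<le> g z" for z using nonneg by (auto simp: g_def split: prod.split)
  qed
  also have "\<dots> = (\<Sum>x\<in>V. \<Sum>S\<in>Pow V. \<Sum>W\<in>Pow (\<Gamma> S). \<Sum>C\<in>conn (insert x W). a (insert x W) C * b S)"
    unfolding I_def g_def using V fin\<Gamma> finconn by (simp add: sum.Sigma finite_SigmaI)
  also have "\<dots> \<le> (\<Sum>x\<in>V. \<Sum>S\<in>Pow V. (1 / real (card V)) ^ card S)"
  proof (intro sum_mono)
    fix x S assume x: "x \<in> V" and S: "S \<in> Pow V"
    have finS: "finite S" using S V finite_subset by blast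
    have "\<Gamma> S = (\<Union>s\<in>S. {y\<in>V. E s y})" by (auto simp: \<Gamma>_def)
    hence "card (\<Gamma> S) \<le> (\<Sum>s\<in>S. card {y\<in>V. E s y})" using finS by (simp add: card_UN_le)
    also have "\<dots> \<le> (\<Sum>s\<in>S. \<Delta>)" using S deg by (intro sum_mono) auto
    finally have c\<Gamma>: "card (\<Gamma> S) \<le> \<Delta> * card S" by (simp add: mult.commute)
    have "(\<Sum>W\<in>Pow (\<Gamma> S). \<Sum>C\<in>conn (insert x W). a (insert x W) C * b S) \<le> (\<Sum>W\<in>Pow (\<Gamma> S). 1 * b S)"
    proof (rule sum_mono)
      fix W assume W: "W \<in> Pow (\<Gamma> S)"
      have "(\<Sum>C\<in>conn (insert x W). a (insert x W) C) \<le> 1"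
        unfolding conn_def a_def using W x by (intro connected_sets_weight V \<Delta> deg) (auto simp: \<Gamma>_def)
      thus "(\<Sum>C\<in>conn (insert x W). a (insert x W) C * b S) \<le> 1 * b S"
        unfolding sum_distrib_right[symmetric] using nonneg by (intro mult_right_mono)
    qed
    also have "\<dots> = 2 ^ card (\<Gamma> S) * b S" using fin\<Gamma> by (simp add: card_Pow)
    also have "\<dots> \<le> 2 ^ (\<Delta> * card S) * b S"
      using c\<Gamma> nonneg by (intro mult_right_mono power_increasing) auto
    also have "\<dots> = (2 * (1 / 2)) ^ (\<Delta> * card S) * (1 / real (card V)) ^ card S"
      unfolding b_def power_mult_distrib by simp
    finally show "(\<Sum>W\<in>Pow (\<Gamma> S). \<Sum>C\<in>conn (insert x W). a (insert x W) C * b S) \<le> (1 / real (card V)) ^ card S"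
      by simp
  qed
  also have "\<dots> = real (card V) * (1 / real (card V) + 1) ^ card V"
    using sum_Pow_weights[OF V(1), of "1 / real (card V)" 1] by simp
  also have "\<dots> \<le> real (card V) * 3"
  proof (rule mult_left_mono)
    have N: "real (card V) > 0" using V by (simp add: card_gt_0_iff)
    have "(1 / real (card V) + 1) ^ card V \<le> exp (1 / real (card V)) ^ card V"
      using N exp_ge_add_one_self[of "1 / real (card V)"] by (intro power_mono) (auto simp: add.commute)
    also have "\<dots> = exp 1" using N by (simp add: exp_of_nat_mult[symmetric])
    also have "\<dots> \<le> 3" by (rule exp_le)
    finally show "(1 / real (card V) + 1) ^ card V \<le> 3" .
  qed simp
  finally show ?thesis by (simp add: a_def b_def mult.commute)
qed

section \<open>The faces drawn by the process\<close>

lemma all_faces_ksets: "all_faces d n = ksets n (Suc d)"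
  by (simp add: all_faces_def ksets_def)

lemma set_random_faces:
  assumes "m \<le> n choose (d + 1)" "fs \<in> set_pmf (random_faces d n m)"
  shows "length fs = m \<and> distinct fs \<and> set fs \<subseteq> ksets n (Suc d)"
  using assms
proof (induction m arbitrary: fs)
  case (Suc m)
  then obtain gs where gs: "gs \<in> set_pmf (random_faces d n m)"
    and fs: "fs \<in> (\<lambda>s. gs @ [s]) ` set_pmf (pmf_of_set (all_faces d n - set gs))" by auto
  have IH: "length gs = m" "distinct gs" "set gs \<subseteq> ksets n (Suc d)" using Suc.IH[OF _ gs] Suc.prems by auto
  have "card (all_faces d n - set gs) = (n choose (d + 1)) - m"
    using IH by (simp add: card_Diff_subset all_faces_ksets card_ksets distinct_card)
  hence "all_faces d n - set gs \<noteq> {}" using Suc.prems(1) by force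
  hence "set_pmf (pmf_of_set (all_faces d n - set gs)) = all_faces d n - set gs"
    by (intro set_pmf_of_set) (auto simp: all_faces_ksets)
  thus ?case using fs IH by (auto simp: all_faces_ksets)
qed auto

lemma finite_set_random_faces:
  assumes "m \<le> n choose (d + 1)"
  shows "finite (set_pmf (random_faces d n m))"
proof (rule finite_subset)
  show "set_pmf (random_faces d n m) \<subseteq> {fs. set fs \<subseteq> ksets n (Suc d) \<and> length fs = m}"
    using set_random_faces[OF assms] by auto
  show "finite {fs. set fs \<subseteq> ksets n (Suc d) \<and> length fs = m}"
    by (rule finite_lists_length_eq) simp
qed

lemma take_random_faces:
  assumes "k \<le> m" "m \<le> n choose (d + 1)"
  shows "map_pmf (take k) (random_faces d n m) = random_faces d n k"
  using assms
proof (induction m rule: dec_induct)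
  case base
  thus ?case using set_random_faces[of k n d] by (intro map_pmf_idI) auto
next
  case (step m)
  have "map_pmf (take k) (random_faces d n (Suc m)) =
      random_faces d n m \<bind> (\<lambda>fs. map_pmf (\<lambda>s. take k (fs @ [s])) (pmf_of_set (all_faces d n - set fs)))"
    by (simp add: map_bind_pmf pmf.map_comp o_def)
  also have "\<dots> = random_faces d n m \<bind> (\<lambda>fs. return_pmf (take k fs))"
  proof (rule bind_pmf_cong[OF refl])
    fix fs assume "fs \<in> set_pmf (random_faces d n m)"
    hence "length fs = m" using set_random_faces[of m n d fs] step.prems by simp
    thus "map_pmf (\<lambda>s. take k (fs @ [s])) (pmf_of_set (all_faces d n - set fs)) = return_pmf (take k fs)"
      using step.hyps by (simp add: map_pmf_const)
  qed
  also have "\<dots> = map_pmf (take k) (random_faces d n m)" by (simp add: map_pmf_def)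
  also have "\<dots> = random_faces d n k" using step by simp
  finally show ?case .
qed

definition avoid_prob :: "nat \<Rightarrow> nat \<Rightarrow> nat \<Rightarrow> nat set set \<Rightarrow> real" where
  "avoid_prob d n m A = measure_pmf.prob (random_faces d n m) {fs. set fs \<inter> A = {}}"

lemma avoid_prob_0: "avoid_prob d n 0 A = 1"
  by (simp add: avoid_prob_def)

lemma avoid_prob_Suc:
  assumes A: "A \<subseteq> ksets n (Suc d)" and m: "Suc m \<le> n choose (d + 1)"
  shows "avoid_prob d n (Suc m) A =
    avoid_prob d n m A * (1 - real (card A) / real ((n choose (d + 1)) - m))"
proof -
  let ?p = "random_faces d n m" and ?T = "n choose (d + 1)"
  let ?q = "1 - real (card A) / real (?T - m)"
  have fin: "finite (set_pmf ?p)" using m by (intro finite_set_random_faces) simp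
  define f where "f fs = map_pmf (\<lambda>s. fs @ [s]) (pmf_of_set (all_faces d n - set fs))" for fs
  have step: "measure_pmf.prob (f fs) {fs. set fs \<inter> A = {}} = indicator {fs. set fs \<inter> A = {}} fs * ?q"
    if fs: "fs \<in> set_pmf ?p" for fs
  proof -
    have fs': "length fs = m" "distinct fs" "set fs \<subseteq> ksets n (Suc d)"
      using set_random_faces[OF _ fs] m by auto
    let ?R = "all_faces d n - set fs"
    have cR: "card ?R = ?T - m"
      using fs' by (simp add: card_Diff_subset all_faces_ksets card_ksets distinct_card)
    have R: "?R \<noteq> {}" "finite ?R" using m cR by (force, simp add: all_faces_ksets)
    have "measure_pmf.prob (f fs) {fs. set fs \<inter> A = {}} =
        measure_pmf.prob (pmf_of_set ?R) {s. set fs \<inter> A = {} \<and> s \<notin> A}"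
      unfolding f_def measure_map_pmf by (rule arg_cong[where f = "measure _"]) auto
    also have "\<dots> = real (card (?R \<inter> {s. set fs \<inter> A = {} \<and> s \<notin> A})) / real (?T - m)"
      using measure_pmf_of_set[OF R] cR by simp
    also have "\<dots> = indicator {fs. set fs \<inter> A = {}} fs * ?q"
    proof (cases "set fs \<inter> A = {}")
      case True
      have AR: "A \<subseteq> ?R" using True A by (auto simp: all_faces_ksets)
      have "?R \<inter> {s. set fs \<inter> A = {} \<and> s \<notin> A} = ?R - A" using True by auto
      hence "card (?R \<inter> {s. set fs \<inter> A = {} \<and> s \<notin> A}) = card ?R - card A"
        using card_Diff_subset[OF finite_subset[OF AR R(2)] AR] by simp
      moreover have "card A \<le> card ?R" using AR R by (intro card_mono) auto
      ultimately show ?thesis using True cR m by (simp add: of_nat_diff field_simps)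
    qed auto
    finally show ?thesis .
  qed
  have "avoid_prob d n (Suc m) A = measure_pmf.expectation (?p \<bind> f) (indicator {fs. set fs \<inter> A = {}})"
    by (simp add: avoid_prob_def f_def[abs_def])
  also have "\<dots> = (\<Sum>fs\<in>set_pmf ?p. pmf ?p fs *\<^sub>R measure_pmf.expectation (f fs) (indicator {fs. set fs \<inter> A = {}}))"
  proof (rule pmf_expectation_bind[OF fin])
    fix fs assume fs: "fs \<in> set_pmf ?p"
    have fs': "length fs = m" "distinct fs" "set fs \<subseteq> ksets n (Suc d)"
      using set_random_faces[OF _ fs] m by auto
    have "card (all_faces d n - set fs) = ?T - m"
      using fs' by (simp add: card_Diff_subset all_faces_ksets card_ksets distinct_card)
    hence "all_faces d n - set fs \<noteq> {}" using m by (metis Suc_le_lessD card.empty less_irrefl zero_less_diff)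
    thus "finite (set_pmf (f fs))" by (simp add: f_def set_pmf_of_set all_faces_ksets)
  qed simp
  also have "\<dots> = (\<Sum>fs\<in>set_pmf ?p. (indicator {fs. set fs \<inter> A = {}} fs * pmf ?p fs) * ?q)"
    by (intro sum.cong refl) (simp add: step)
  also have "\<dots> = (\<Sum>fs\<in>set_pmf ?p. indicator {fs. set fs \<inter> A = {}} fs * pmf ?p fs) * ?q"
    by (rule sum_distrib_right[symmetric])
  also have "(\<Sum>fs\<in>set_pmf ?p. indicator {fs. set fs \<inter> A = {}} fs * pmf ?p fs) =
      measure_pmf.expectation ?p (indicator {fs. set fs \<inter> A = {}})"
    by (rule integral_measure_pmf_real[symmetric]) (use fin in auto)
  also have "\<dots> = avoid_prob d n m A" by (simp add: avoid_prob_def)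
  finally show ?thesis .
qed

lemma divide_diff_mono:
  assumes "j \<le> m" "m < (T::nat)"
  shows "real a / real (T - j) \<le> real a / real (T - m)"
  using assms by (intro divide_left_mono mult_pos_pos) auto

lemma avoid_prob_nonneg: "avoid_prob d n m A \<ge> 0"
  by (simp add: avoid_prob_def)

lemma avoid_prob_le:
  assumes A: "A \<subseteq> ksets n (Suc d)" and m: "m \<le> n choose (d + 1)"
  shows "avoid_prob d n m A \<le> exp (- real (card A) * real m / real (n choose (d + 1)))"
  using m
proof (induction m)
  case 0
  show ?case by (simp add: avoid_prob_0)
next
  case (Suc m)
  let ?T = "n choose (d + 1)"
  have "avoid_prob d n (Suc m) A = avoid_prob d n m A * (1 - real (card A) / real (?T - m))"
    using A Suc.prems by (rule avoid_prob_Suc)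
  also have "\<dots> \<le> avoid_prob d n m A * exp (- real (card A) / real ?T)"
  proof (rule mult_left_mono[OF _ avoid_prob_nonneg])
    have "real (card A) / real ?T \<le> real (card A) / real (?T - m)"
      using divide_diff_mono[of 0 m ?T] Suc.prems by simp
    moreover have "1 + (- real (card A) / real ?T) \<le> exp (- real (card A) / real ?T)"
      by (rule exp_ge_add_one_self)
    ultimately show "1 - real (card A) / real (?T - m) \<le> exp (- real (card A) / real ?T)" by simp
  qed
  also have "\<dots> \<le> exp (- real (card A) * real m / real ?T) * exp (- real (card A) / real ?T)"
    using Suc by (intro mult_right_mono) auto
  also have "\<dots> = exp (- real (card A) * real (Suc m) / real ?T)"
    by (simp add: exp_add[symmetric] add_divide_distrib[symmetric] algebra_simps)
  finally show ?case .
qed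

lemma avoid_prob_ge:
  assumes A: "A \<subseteq> ksets n (Suc d)" and m: "m \<le> n choose (d + 1)"
    and x: "real (card A) / real ((n choose (d + 1)) - m) \<le> x" "x < 1" and pos: "m < n choose (d + 1)"
  shows "(1 - x) ^ m \<le> avoid_prob d n m A"
proof -
  let ?T = "n choose (d + 1)"
  have "(1 - x) ^ j \<le> avoid_prob d n j A" if "j \<le> m" for j
    using that
  proof (induction j)
    case (Suc j)
    have "real (card A) / real (?T - j) \<le> real (card A) / real (?T - m)"
      using Suc.prems pos by (intro divide_diff_mono) auto
    from order_trans[OF this x(1)] have "1 - x \<le> 1 - real (card A) / real (?T - j)" by simp
    hence "(1 - x) ^ j * (1 - x) \<le> avoid_prob d n j A * (1 - real (card A) / real (?T - j))"
      using Suc x avoid_prob_nonneg by (intro mult_mono) auto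
    thus ?case using avoid_prob_Suc[OF A, of j] Suc.prems m by (simp add: mult.commute)
  qed (simp add: avoid_prob_0)
  thus ?thesis by simp
qed

text \<open>
  Drawing without replacement makes avoidance of disjoint sets negatively correlated: each
  step contributes \<open>1 - 2 a x \<le> (1 - a x)\<^sup>2\<close>. One common element costs an additional factor
  \<open>1 + 2 x\<close> per step.
\<close>

lemma avoid_prob_Un_le:
  assumes A: "A \<subseteq> ksets n (Suc d)" and B: "B \<subseteq> ksets n (Suc d)" and m: "m \<le> n choose (d + 1)"
    and card: "card A = a" "card B = a" "card (A \<inter> B) \<le> i" "i \<le> 1"
    and small: "4 * a * a \<le> (n choose (d + 1)) - m" and pos: "m < n choose (d + 1)"
  shows "avoid_prob d n m (A \<union> B) \<le>
    avoid_prob d n m A * avoid_prob d n m B * (1 + 2 * real i / real ((n choose (d + 1)) - m)) ^ m"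
proof -
  let ?T = "n choose (d + 1)"
  let ?y = "1 + 2 * real i / real (?T - m)"
  have finAB: "finite A" "finite B" using A B ksets_finite finite_subset by blast+
  have cU: "real (card (A \<union> B)) \<ge> 2 * real a - real i"
    using card_Un_Int[OF finAB] card by linarith
  have "avoid_prob d n j (A \<union> B) \<le> avoid_prob d n j A * avoid_prob d n j B * ?y ^ j" if "j \<le> m" for j
    using that
  proof (induction j)
    case (Suc j)
    define x where "x = 1 / real (?T - j)"
    have Tj: "?T - m \<le> ?T - j" "?T - j > 0" using Suc.prems pos by auto
    have x: "x > 0" "real (4 * a * a) * x \<le> 1"
      using Tj small by (auto simp: x_def field_simps simp flip: of_nat_mult)
    have xm: "x \<le> 1 / real (?T - m)" unfolding x_def using divide_diff_mono[of j m ?T 1] Suc.prems pos by simp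
    have key: "1 - (2 * real a - real i) * x \<le> (1 - real a * x) * (1 - real a * x) * (1 + 2 * real i * x)"
    proof (cases "i = 0")
      case True
      have "0 \<le> (real a * x) * (real a * x)" by simp
      thus ?thesis using True by (simp add: algebra_simps)
    next
      case False
      hence i: "i = 1" using card by simp
      have ax: "4 * real a * x \<le> 1"
      proof (cases "a = 0")
        case False
        hence "4 * real a * 1 \<le> 4 * real a * real a" by (intro mult_left_mono) auto
        from mult_right_mono[OF this, of x] show ?thesis using x by simp
      qed simp
      have "(1 - real a * x) * (1 - real a * x) * (1 + 2 * x) - (1 - (2 * real a - 1) * x)
          = x * (1 - 4 * real a * x) + (real a * x)^2 * (1 + 2 * x)"
        by (simp add: algebra_simps power2_eq_square)
      also have "\<dots> \<ge> 0" using ax x by (intro add_nonneg_nonneg mult_nonneg_nonneg) auto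
      finally show ?thesis using i by simp
    qed
    have one: "0 \<le> 1 - real a * x"
    proof -
      have "real a \<le> real (4 * a * a)" by (cases a) auto
      hence "real a * x \<le> real (4 * a * a) * x" using x by (intro mult_right_mono) auto
      thus ?thesis using x by linarith
    qed
    have "avoid_prob d n (Suc j) (A \<union> B) = avoid_prob d n j (A \<union> B) * (1 - real (card (A \<union> B)) * x)"
      using avoid_prob_Suc[of "A \<union> B" n d j] A B Suc.prems m by (simp add: x_def)
    also have "\<dots> \<le> avoid_prob d n j (A \<union> B) * (1 - (2 * real a - real i) * x)"
      using cU x by (intro mult_left_mono avoid_prob_nonneg) (simp add: mult_right_mono)
    also have "\<dots> \<le> avoid_prob d n j (A \<union> B) * ((1 - real a * x) * (1 - real a * x) * ?y)"
    proof (intro mult_left_mono avoid_prob_nonneg)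
      have "(1 - real a * x) * (1 - real a * x) * (1 + 2 * real i * x) \<le> (1 - real a * x) * (1 - real a * x) * ?y"
        using one xm mult_left_mono[OF xm, of "2 * real i"] by (intro mult_left_mono mult_nonneg_nonneg) auto
      thus "1 - (2 * real a - real i) * x \<le> (1 - real a * x) * (1 - real a * x) * ?y" using key by linarith
    qed
    also have "\<dots> \<le> (avoid_prob d n j A * avoid_prob d n j B * ?y ^ j) * ((1 - real a * x) * (1 - real a * x) * ?y)"
      using Suc one by (intro mult_right_mono mult_nonneg_nonneg) auto
    also have "\<dots> = avoid_prob d n (Suc j) A * avoid_prob d n (Suc j) B * ?y ^ Suc j"
      using avoid_prob_Suc[OF A, of j] avoid_prob_Suc[OF B, of j] Suc.prems m card by (simp add: x_def)
    finally show ?case .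
  qed (simp add: avoid_prob_0)
  thus ?thesis by simp
qed

lemma avoid_prob_cong_card:
  assumes A: "A \<subseteq> ksets n (Suc d)" and B: "B \<subseteq> ksets n (Suc d)" and m: "m \<le> n choose (d + 1)"
    and card: "card A = card B"
  shows "avoid_prob d n m A = avoid_prob d n m B"
  using m by (induction m) (simp_all add: avoid_prob_0 avoid_prob_Suc[OF A] avoid_prob_Suc[OF B] card)

section \<open>Comparison of the hitting times\<close>

lemma uncovered_antimono: "F \<subseteq> F' \<Longrightarrow> uncovered n d F' \<subseteq> uncovered n d F"
  by (auto simp: uncovered_def)

lemma uncovered_all_faces:
  assumes "d < n"
  shows "uncovered n d (ksets n (Suc d)) = {}"
proof -
  have "\<exists>s\<in>ksets n (Suc d). a \<subseteq> s" if a: "a \<in> ksets n d" for a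
  proof -
    have "{s \<in> ksets n (Suc d). a \<subseteq> s} \<noteq> {}" 
      using card_cofaces[OF a] assms by force
    thus ?thesis by blast
  qed
  thus ?thesis by (auto simp: uncovered_def)
qed

text \<open>
  The existence of an isolated face at time \<open>m\<close> forces \<open>m \<le> M1\<close>, so that the absence of clusters at time
  \<open>m\<close> applies to the complex at time \<open>M1\<close>.
\<close>

lemma hitting_times_agree:
  assumes d: "d \<ge> 2" and n: "(d + 1)\<^sup>2 \<le> n"
    and fs: "fs \<in> set_pmf (face_process d n)"
    and no_cluster: "\<And>C. C \<in> clusters n d \<Longrightarrow> cob n d C \<inter> set (take m fs) \<noteq> {}"
    and isol: "uncovered n d (set (take m fs)) \<noteq> {}"
  shows "M1 d n fs = M2 d n fs"
proof -
  let ?T = "n choose (d + 1)"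
  define unc where "unc j = uncovered n d (set (take j fs))" for j
  define triv where "triv j \<longleftrightarrow> trivial_group (cohomology (d - 1) (Y d n fs j))" for j
  obtain k where k: "d = Suc (Suc k)" using d by (metis Suc_le_D numeral_2_eq_2 Suc_le_mono)
  have dn: "d < n" using n by (auto simp: power2_eq_square)
  have fs': "length fs = ?T" "distinct fs" "set fs \<subseteq> ksets n (Suc d)"
    using set_random_faces[of ?T n d fs] fs by (auto simp: face_process_def)
  have sub: "set (take j fs) \<subseteq> ksets n (Suc d)" for j using fs'(3) set_take_subset by fastforce
  have tc: "top_complex n k (set (take j fs))" for j using sub k by unfold_locales simp
  have iso: "(\<exists>s. isolated (Y d n fs j) (d - 1) s) \<longleftrightarrow> unc j \<noteq> {}" for j
    using isolated_skel_iff[of "set (take j fs)" n "Suc k"] sub k by (auto simp: Y_skel unc_def)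
  have M1: "M1 d n fs = (LEAST j. j \<le> ?T \<and> unc j = {})" unfolding M1_def iso by simp
  have M2: "M2 d n fs = (LEAST j. j \<le> ?T \<and> triv j)" by (simp add: M2_def triv_def)
  have triv_imp: "unc j = {}" if "triv j" for j
    using top_complex.trivial_cohomology_imp_covered[OF tc, of j] that dn k
    by (simp add: triv_def unc_def Y_skel)
  have "card (set fs) = ?T" using fs' distinct_card by metis
  hence "set fs = ksets n (Suc d)" using fs'(3) by (intro card_subset_eq) (auto simp: card_ksets)
  hence "?T \<le> ?T \<and> unc ?T = {}" using uncovered_all_faces[OF dn] fs' by (simp add: unc_def)
  hence h: "M1 d n fs \<le> ?T \<and> unc (M1 d n fs) = {}" unfolding M1 by (rule LeastI)
  have "m \<le> M1 d n fs"
  proof (rule ccontr)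
    assume "\<not> ?thesis"
    hence "unc m \<subseteq> unc (M1 d n fs)"
      unfolding unc_def by (intro uncovered_antimono set_take_subset_set_take) simp
    thus False using h isol by (simp add: unc_def)
  qed
  have "triv (M1 d n fs)"
  proof -
    have "\<exists>B. A = cob n (Suc k) B"
      if "A \<subseteq> ksets n (Suc (Suc k))" "cob n (Suc (Suc k)) A \<inter> set (take (M1 d n fs) fs) = {}" for A
    proof (rule mod2_cohomology_vanishes)
      show "(Suc k + 2)\<^sup>2 \<le> n" using n k by simp
      show "set (take m fs) \<subseteq> set (take (M1 d n fs) fs)"
        using \<open>m \<le> M1 d n fs\<close> by (rule set_take_subset_set_take)
      show "set (take (M1 d n fs) fs) \<subseteq> ksets n (Suc (Suc (Suc k)))" using sub k by simp
      show "uncovered n (Suc (Suc k)) (set (take (M1 d n fs) fs)) = {}" using h k by (simp add: unc_def)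
      show "cob n (Suc (Suc k)) C \<inter> set (take m fs) \<noteq> {}" if "C \<in> clusters n (Suc (Suc k))" for C
        using no_cluster[of C] that k by simp
    qed (use that in auto)
    thus ?thesis
      using top_complex.rational_cohomology_vanishes[OF tc] dn k by (simp add: triv_def Y_skel)
  qed
  show ?thesis unfolding M2
  proof (rule Least_equality[symmetric])
    show "M1 d n fs \<le> ?T \<and> triv (M1 d n fs)" using h \<open>triv (M1 d n fs)\<close> by simp
    show "M1 d n fs \<le> j" if "j \<le> ?T \<and> triv j" for j
      unfolding M1 using that triv_imp by (intro Least_le) auto
  qed
qed

lemma hitting_times_prob:
  assumes d: "d \<ge> 2" and n: "(d + 1)\<^sup>2 \<le> n" and m: "m \<le> n choose (d + 1)"
  shows "1 - (\<Sum>C\<in>clusters n d. avoid_prob d n m (cob n d C))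
      - measure_pmf.prob (random_faces d n m) {fs. uncovered n d (set fs) = {}}
    \<le> measure_pmf.prob (face_process d n) {fs. M1 d n fs = M2 d n fs}"
proof -
  let ?P = "face_process d n" and ?K = "clusters n d"
  have finK: "finite ?K"
    by (rule finite_subset[of _ "Pow (ksets n d)"]) (auto simp: clusters_def)
  have take: "measure_pmf.prob ?P {fs. Q (take m fs)} = measure_pmf.prob (random_faces d n m) {fs. Q fs}" for Q
  proof -
    have "random_faces d n m = map_pmf (take m) ?P"
      unfolding face_process_def using take_random_faces[OF m order_refl] by simp
    thus ?thesis by (simp add: vimage_def)
  qed
  define bad1 where "bad1 = (\<Union>C\<in>?K. {fs. set (take m fs) \<inter> cob n d C = {}})"
  define bad2 where "bad2 = {fs. uncovered n d (set (take m fs)) = {}}"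
  have "measure_pmf.prob ?P bad1 \<le> (\<Sum>C\<in>?K. measure_pmf.prob ?P {fs. set (take m fs) \<inter> cob n d C = {}})"
    unfolding bad1_def using finK by (intro measure_pmf.finite_measure_subadditive_finite) auto
  also have "\<dots> = (\<Sum>C\<in>?K. avoid_prob d n m (cob n d C))"
    unfolding avoid_prob_def using take[of "\<lambda>fs. set fs \<inter> cob n d C = {}" for C] by simp
  finally have b1: "measure_pmf.prob ?P bad1 \<le> \<dots>" .
  have b2: "measure_pmf.prob ?P bad2 = measure_pmf.prob (random_faces d n m) {fs. uncovered n d (set fs) = {}}"
    unfolding bad2_def by (rule take)
  have "1 - measure_pmf.prob ?P {fs. M1 d n fs = M2 d n fs} = measure_pmf.prob ?P {fs. M1 d n fs \<noteq> M2 d n fs}"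
    by (subst measure_pmf.prob_compl[symmetric]) (auto intro!: arg_cong[where f = "measure _"])
  also have "\<dots> \<le> measure_pmf.prob ?P (bad1 \<union> bad2)"
  proof (rule measure_pmf.finite_measure_mono_AE)
    show "AE fs in measure_pmf ?P. fs \<in> {fs. M1 d n fs \<noteq> M2 d n fs} \<longrightarrow> fs \<in> bad1 \<union> bad2"
      unfolding AE_measure_pmf_iff
    proof (intro ballI impI)
      fix fs assume fs: "fs \<in> set_pmf ?P" "fs \<in> {fs. M1 d n fs \<noteq> M2 d n fs}"
      show "fs \<in> bad1 \<union> bad2"
      proof (rule ccontr)
        assume "fs \<notin> bad1 \<union> bad2"
        hence "cob n d C \<inter> set (take m fs) \<noteq> {}" if "C \<in> ?K" for C
          using that unfolding bad1_def by (simp add: Int_commute)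
        moreover have "uncovered n d (set (take m fs)) \<noteq> {}"
          using \<open>fs \<notin> bad1 \<union> bad2\<close> by (simp add: bad2_def)
        ultimately have "M1 d n fs = M2 d n fs" using d n fs(1) by (intro hitting_times_agree)
        thus False using fs(2) by simp
      qed
    qed
  qed simp
  also have "\<dots> \<le> measure_pmf.prob ?P bad1 + measure_pmf.prob ?P bad2"
    by (intro measure_Un_le) auto
  finally show ?thesis using b1 b2 by linarith
qed

section \<open>No cluster is a cocycle\<close>

lemma degree_le:
  assumes a: "a \<in> ksets n d"
  shows "card {b \<in> ksets n d. adj a b} \<le> d * n"
proof -
  have fin: "finite a" using a by (rule finite_if_in_ksets)
  have ca: "card a = d" "a \<subseteq> {1..n}" using a by (auto simp: ksets_def)
  have "{b \<in> ksets n d. adj a b} \<subseteq> (\<lambda>(x, y). insert y (a - {x})) ` (a \<times> {1..n})"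
  proof
    fix b assume "b \<in> {b \<in> ksets n d. adj a b}"
    hence b: "b \<in> ksets n d" "adj a b" by auto
    have finb: "finite b" using b(1) by (rule finite_if_in_ksets)
    have cb: "card b = d" "b \<subseteq> {1..n}" using b(1) by (auto simp: ksets_def)
    have "card (a \<union> b) = Suc d" using b(2) ca by (simp add: adj_def)
    moreover have "card ((a \<union> b) - a) = card (a \<union> b) - card a" "card ((a \<union> b) - b) = card (a \<union> b) - card b"
      using fin finb by (simp_all only: card_Diff_subset Un_upper1 Un_upper2)
    moreover have "(a \<union> b) - a = b - a" "(a \<union> b) - b = a - b" by blast+
    ultimately have "card (b - a) = 1" "card (a - b) = 1" using ca cb by simp_all
    then obtain x y where xy: "a - b = {x}" "b - a = {y}" by (auto simp: card_1_singleton_iff)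
    hence "b = insert y (a - {x})" "x \<in> a" "y \<in> {1..n}" using cb by auto
    thus "b \<in> (\<lambda>(x, y). insert y (a - {x})) ` (a \<times> {1..n})" by force
  qed
  hence "card {b \<in> ksets n d. adj a b} \<le> card ((\<lambda>(x, y). insert y (a - {x})) ` (a \<times> {1..n}))"
    using fin by (intro card_mono) auto
  also have "\<dots> \<le> card (a \<times> {1..n})" using fin by (intro card_image_le) auto
  also have "\<dots> = d * n" using ca by (simp add: card_cartesian_product)
  finally show ?thesis .
qed

text \<open>
  A non-empty \<open>S\<close> is given a root adjacent to it, so that the attached elements, those of \<open>C\<close> outside
  the root and not adjacent to \<open>S\<close>, are exactly the ones counted in the last inequality. For empty \<open>S\<close> the
  root is itself one of them, and there is one attached element less; this saves a factor \<open>n\<close>, which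
  matters for clusters of bounded size.
\<close>

lemma cluster_root_cover:
  assumes C: "C \<in> clusters n d" and t: "t \<ge> 1"
  shows "\<exists>S r. S \<subseteq> C \<and> r \<in> C \<and> (S = {} \<or> (\<exists>s\<in>S. adj s r)) \<and>
    card S * t \<le> card C \<and>
    card (C - {c\<in>C. \<exists>s\<in>S. adj s c}) * (n - d) \<le> card (cob n d C) + t * card C"
proof -
  have CK: "C \<subseteq> ksets n d" and C2: "2 \<le> card C" using C by (auto simp: clusters_def)
  have finC: "finite C" using CK ksets_finite finite_subset by blast
  obtain S where S: "S \<subseteq> C" "card S * t \<le> card {c\<in>C. \<exists>s\<in>S. adj s c}"
    "\<And>c. c \<in> C \<Longrightarrow> card {u\<in>C - {c\<in>C. \<exists>s\<in>S. adj s c}. adj c u} \<le> t"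
    using greedy_cover[OF finC t, of adj] by blast
  have "\<exists>r\<in>C. S = {} \<or> (\<exists>s\<in>S. adj s r)"
  proof (cases "S = {}")
    case True
    have "C \<noteq> {}" using C2 by auto
    thus ?thesis using True by blast
  next
    case False
    have "finite S" using S(1) finC finite_subset by blast
    hence "card S * t > 0" using False t by (simp add: card_gt_0_iff)
    hence "card {c\<in>C. \<exists>s\<in>S. adj s c} > 0" using S(2) by linarith
    hence "{c\<in>C. \<exists>s\<in>S. adj s c} \<noteq> {}" by (metis card.empty less_irrefl)
    thus ?thesis by blast
  qed
  then obtain r where r: "r \<in> C" "S = {} \<or> (\<exists>s\<in>S. adj s r)" by blast
  have "card {c\<in>C. \<exists>s\<in>S. adj s c} \<le> card C" using finC by (intro card_mono) auto
  hence "card S * t \<le> card C" using S(2) by linarith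
  moreover have "card (C - {c\<in>C. \<exists>s\<in>S. adj s c}) * (n - d) \<le> card (cob n d C) + t * card C"
    by (rule cob_lower_bound[OF CK _ S(3)]) auto
  ultimately show ?thesis using S(1) r by blast
qed

text \<open>
  In units of \<open>ln n\<close>, the right-hand side is the exponent of the probability that a cluster of size \<open>k\<close> with
  coboundary of size \<open>b\<close> survives, \<open>d + u\<close> is the cost of the root and of the elements not adjacent to
  \<open>S\<close>, and \<open>k / (16 (d + 1))\<close> is reserved for all costs that are bounded per element.

  The threshold \<open>t\<close> is about \<open>n / (16 d)\<close>, so that the loss \<open>t k\<close> is small compared with \<open>n k\<close>.
  For \<open>s = 0\<close> the coboundary has nearly \<open>n k\<close> elements, and the gain is about \<open>(d - 1) (k - 1)\<close>, which is at
  least \<open>k / 2\<close>. For \<open>s > 0\<close> write the factor \<open>d - 1/16\<close> as at least \<open>1 + 1/2\<close>: one copy of \<open>b / n\<close>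
  pays for \<open>u\<close> up to a small multiple of \<open>k\<close>, and half of another copy is at least \<open>k / (2 (d + 1))\<close> by
  expansion. In this case \<open>k \<ge> t\<close> is of order \<open>n\<close>, so the constant cost \<open>d\<close> of the root is negligible.
\<close>

lemma cluster_exponent:
  fixes d n k b u s t :: nat
  defines "c \<equiv> real d - 1 / 16"
  assumes d: "d \<ge> 2" and n: "16 * d * (d + 1) \<le> n"
    and t: "real t \<le> real n / (16 * real d) + 1" "real n / (16 * real d) \<le> real t"
    and n2: "64 * (real d + 1)\<^sup>2 * real d * 16 / 3 \<le> real n"
    and k: "2 \<le> k" and u: "u \<le> k"
    and s: "s * t \<le> k"
    and expand: "n * k \<le> (d + 1) * b"
    and empty: "s = 0 \<Longrightarrow> u + 1 = k \<and> k * (n - d) \<le> b + t * k"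
    and nonempty: "s > 0 \<Longrightarrow> u * (n - d) \<le> b + t * k"
  shows "1 / 8 + real u + real d + real k / (16 * (real d + 1)) \<le> c * real b / real n"
proof -
  define D where "D = real d"
  have D: "D \<ge> 2" using d by (simp add: D_def)
  define x where "x = real n"
  have xbig: "x \<ge> 16 * D * (D + 1)" 
  proof -
    have "real (16 * d * (d + 1)) \<le> real n" using n by (simp only: of_nat_le_iff)
    thus ?thesis by (simp add: x_def D_def algebra_simps)
  qed
  have "16 * D * (D + 1) > 0" using D by simp
  hence x: "x > 0" using xbig by linarith
  have dn: "d \<le> n" 
  proof -
    have "d * 1 \<le> d * (16 * (d + 1))" by (intro mult_le_mono2) simp
    thus ?thesis using n by (simp add: algebra_simps)
  qed
  (* Measure b and t in units of n; the terms of lower order are then 1/x and D/x. *)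
  define \<beta> where "\<beta> = real b / x"
  define \<tau> where "\<tau> = real t / x"
  define K where "K = real k"
  define U where "U = real u"
  define Z where "Z = K / (16 * (D + 1))"
  have Z: "K / (D + 1) = 16 * Z" using D by (simp add: Z_def divide_simps)
  have K: "K \<ge> 2" "U \<le> K" "U \<ge> 0" using k u by (auto simp: K_def U_def)
  have Dx: "D / x \<le> 1 / (16 * (D + 1))" "1 / x \<le> 1 / (16 * D * (D + 1))"
  proof -
    have pos: "16 * D * (D + 1) > 0" using D by simp
    show "1 / x \<le> 1 / (16 * D * (D + 1))" 
      by (rule divide_left_mono[OF xbig _ mult_pos_pos[OF x pos]]) simp
    hence "D * (1 / x) \<le> D * (1 / (16 * D * (D + 1)))" using D by (intro mult_left_mono) auto
    thus "D / x \<le> 1 / (16 * (D + 1))" using D by simp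
  qed
  have frac: "1 / (16 * (D + 1)) + 1 / (16 * D) + 1 / (16 * D * (D + 1)) = 1 / (8 * D)"
  proof -
    have 1: "1 / (16 * (D + 1)) = D / (16 * D * (D + 1))" using D by simp
    have 2: "1 / (16 * D) = (D + 1) / (16 * D * (D + 1))" using D by simp
    have 3: "1 / (8 * D) = (D + (D + 1) + 1) / (16 * D * (D + 1))" using D by (simp add: divide_simps)
    show ?thesis unfolding 3 by (simp only: 1 2 add_divide_distrib)
  qed
  have \<tau>: "\<tau> \<le> 1 / (16 * D) + 1 / x"
  proof -
    have "\<tau> \<le> (x / (16 * D) + 1) / x" unfolding \<tau>_def using t x by (intro divide_right_mono) (auto simp: x_def D_def)
    also have "\<dots> = 1 / (16 * D) + 1 / x" using x D by (simp add: field_simps)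
    finally show ?thesis .
  qed
  have sub: "real (n - d) = x - D" using dn by (simp add: x_def D_def of_nat_diff)
  have \<beta>1: "K / (D + 1) \<le> \<beta>"
  proof -
    have "real (n * k) \<le> real ((d + 1) * b)" using expand by (simp only: of_nat_le_iff)
    hence "x * K \<le> (D + 1) * real b" by (simp add: x_def K_def D_def algebra_simps)
    thus ?thesis using x D by (simp add: \<beta>_def field_simps)
  qed
  have bound: "real v * (1 - D / x) - \<tau> * K \<le> \<beta>" if "v * (n - d) \<le> b + t * k" for v
  proof -
    have "real (v * (n - d)) \<le> real (b + t * k)" using that by (simp only: of_nat_le_iff)
    hence "real v * (x - D) - real t * K \<le> real b" using sub by (simp add: K_def)
    hence "(real v * (x - D) - real t * K) / x \<le> real b / x" using x by (intro divide_right_mono) auto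
    moreover have "(real v * (x - D) - real t * K) / x = real v * (1 - D / x) - real t / x * K"
      using x by (simp add: diff_divide_distrib right_diff_distrib)
    ultimately show ?thesis by (simp add: \<beta>_def \<tau>_def)
  qed
  have cb: "c * real b / real n = (D - 1 / 16) * \<beta>" by (simp add: c_def \<beta>_def x_def D_def)
  have "1 / 8 + U + D + Z \<le> (D - 1 / 16) * \<beta>"
  proof (cases "s = 0")
    case True
    (* The root is the only element of W here, which saves the 1 needed for K = 2. *)
    have U: "U = K - 1" using empty[OF True] by (auto simp: U_def K_def)
    have "K * (1 - D / x) - \<tau> * K \<le> \<beta>" using bound[of k] empty[OF True] by (simp add: K_def)
    moreover have "K * (1 - 1 / (16 * (D + 1)) - 1 / (16 * D) - 1 / (16 * D * (D + 1))) \<le> K * (1 - D / x - \<tau>)"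
      using Dx \<tau> K by (intro mult_left_mono) auto
    moreover note frac
    ultimately have "K * (1 - 1 / (8 * D)) \<le> K * (1 - D / x - \<tau>)" "K * (1 - D / x - \<tau>) \<le> \<beta>"
      by (simp_all only: diff_diff_eq right_diff_distrib mult.commute) (simp_all add: algebra_simps)
    hence "K * (1 - 1 / (8 * D)) \<le> \<beta>" by linarith
    hence "(D - 1 / 16) * (K * (1 - 1 / (8 * D))) \<le> (D - 1 / 16) * \<beta>" using D by (intro mult_left_mono) auto
    moreover have "(D - 1 / 16) * (1 - 1 / (8 * D)) \<ge> D - 3 / 16"
      using D by (simp add: field_simps)
    hence "K * ((D - 1 / 16) * (1 - 1 / (8 * D))) \<ge> K * (D - 3 / 16)" using K by (intro mult_left_mono) auto
    ultimately have 1: "K * (D - 3 / 16) \<le> (D - 1 / 16) * \<beta>" by (simp add: mult.left_commute)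
    have "(D - 2) * (K - 1) \<ge> 0" using D K by simp
    hence "D * K \<ge> 2 * (K - 1) + D" by (simp add: algebra_simps)
    moreover have "Z \<le> K / 48" unfolding Z_def using D K by (intro divide_left_mono) auto
    ultimately have "1 / 8 + (K - 1) + D + Z \<le> D * K - 3 / 16 * K"
      using K(1) by argo
    also have "\<dots> = K * (D - 3 / 16)" by (simp add: algebra_simps)
    finally have "1 / 8 + (K - 1) + D + Z \<le> K * (D - 3 / 16)" .
    thus ?thesis using 1 U by linarith
  next
    case False
    hence "U * (1 - D / x) - \<tau> * K \<le> \<beta>" using bound[of u] nonempty by (simp add: U_def)
    hence "U - K * (D / x) - \<tau> * K \<le> \<beta>"
      using mult_right_mono[OF K(2), of "D / x"] D x by (simp add: algebra_simps)
    moreover have "K * (D / x + \<tau>) \<le> K * (1 / (8 * D))"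
    proof (rule mult_left_mono)
      show "D / x + \<tau> \<le> 1 / (8 * D)" using Dx \<tau> frac by linarith
    qed (use K in simp)
    ultimately have 1: "U - K / (8 * D) \<le> \<beta>" by (simp add: algebra_simps)
    have \<beta>0: "\<beta> \<ge> 0" using x by (simp add: \<beta>_def)
    have "(D - 1 / 16) * \<beta> \<ge> (3 / 2) * \<beta>" using D \<beta>0 by (intro mult_right_mono) auto
    hence "(D - 1 / 16) * \<beta> \<ge> (U - K / (8 * D)) + 8 * Z" using 1 \<beta>1 Z by linarith
    moreover have "K / (8 * D) \<le> 3 * Z"
    proof -
      have "1 / (8 * D) \<le> 3 / (16 * (D + 1))" using D by (simp add: divide_simps)
      thus ?thesis using mult_left_mono[of "1 / (8 * D)" "3 / (16 * (D + 1))" K] K by (simp add: Z_def)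
    qed
    moreover have "1 / 8 + D \<le> 4 * Z"
    proof -
      have "t \<le> s * t" using False by (cases s) auto
      hence "real t \<le> K" using s unfolding K_def by (metis le_trans of_nat_le_iff)
      hence "x / (16 * D) \<le> K" using t by (simp add: x_def D_def)
      moreover have "64 * (D + 1)\<^sup>2 / 3 \<le> x / (16 * D)"
        using n2 D by (simp add: field_simps x_def D_def)
      ultimately have "64 * (D + 1)\<^sup>2 / 3 \<le> K" by linarith
      hence "64 * (D + 1) / 3 \<le> K / (D + 1)" using D by (simp add: pos_le_divide_eq power2_eq_square algebra_simps)
      thus ?thesis using D Z by argo
    qed
    ultimately show ?thesis by argo
  qed
  thus ?thesis unfolding cb by (simp add: U_def D_def K_def Z_def)
qed

text \<open>
  The union bound over all clusters: the probability that a cluster survives is at most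
  \<open>n powr (- 1 / 8) / N\<close> times its weight in \<open>rooted_cover_weight\<close>, where \<open>N\<close> is the number of
  \<open>d\<close>-subsets.
\<close>

lemma cluster_sum_bound:
  fixes d n m t :: nat
  defines "c \<equiv> real d - 1 / 16" and "T \<equiv> n choose (d + 1)"
  defines "t \<equiv> nat \<lceil>real n / (16 * real d)\<rceil>"
  assumes d: "d \<ge> 2" and n: "16 * d * (d + 1) \<le> n"
    and n2: "64 * (real d + 1)\<^sup>2 * real d * 16 / 3 \<le> real n"
    and ln: "ln (2 * real d) + ln 2 + 16 * (real d)\<^sup>2 * ln 2 + 16 * (real d)\<^sup>2 * ln (real n) / real n
      \<le> ln (real n) / (16 * (real d + 1))"
    and m: "m \<le> T" "c * real T * ln (real n) / real n \<le> real m"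
  shows "(\<Sum>C\<in>clusters n d. avoid_prob d n m (cob n d C)) \<le> 3 * real n powr (- 1 / 8)"
proof -
  let ?V = "ksets n d" and ?K = "clusters n d"
  define N where "N = card ?V"
  define \<Delta> where "\<Delta> = d * n"
  have dn: "d < n"
  proof -
    have "d * 1 < (d + 1) * (16 * d)" using d by (intro mult_less_le_imp_less) auto
    thus ?thesis using n by (simp add: algebra_simps)
  qed
  have npos: "real n > 1" using dn d by simp
  have Npos: "N > 0" using dn by (simp add: N_def card_ksets)
  have Nle: "real N \<le> real n ^ d"
    using binomial_le_pow[of d n] dn by (simp add: N_def card_ksets flip: of_nat_power)
  have Tpos: "T > 0" using dn by (simp add: T_def)
  have t1: "t \<ge> 1" "real n / (16 * real d) \<le> real t" "real t \<le> real n / (16 * real d) + 1"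
  proof -
    have "real n / (16 * real d) > 0" using npos d by simp
    thus "t \<ge> 1" unfolding t_def by linarith
    show "real n / (16 * real d) \<le> real t" unfolding t_def by (rule of_nat_ceiling)
    show "real t \<le> real n / (16 * real d) + 1"
      unfolding t_def using \<open>real n / (16 * real d) > 0\<close> by linarith
  qed
  define good where "good C S r \<longleftrightarrow> S \<subseteq> C \<and> r \<in> C \<and> (S = {} \<or> (\<exists>s\<in>S. adj s r)) \<and>
    card S * t \<le> card C \<and>
    card (C - {c\<in>C. \<exists>s\<in>S. adj s c}) * (n - d) \<le> card (cob n d C) + t * card C" for C S r
  define S where "S C = (SOME S. \<exists>r. good C S r)" for C
  define r where "r C = (SOME r. good C (S C) r)" for C
  have good: "good C (S C) (r C)" if "C \<in> ?K" for C
  proof -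
    have "\<exists>S r. good C S r" unfolding good_def by (rule cluster_root_cover[OF that t1(1)])
    hence "\<exists>r. good C (S C) r" unfolding S_def by (rule someI_ex)
    thus ?thesis unfolding r_def by (rule someI_ex)
  qed
  note Sr = good[unfolded good_def]
  define W where "W C = insert (r C) {c\<in>C. \<exists>s\<in>S C. adj s c}" for C
  define wt where "wt C = (1 / (2 * real \<Delta>)) ^ card (C - W C) * (1 / 2) ^ card C
            * ((1 / 2) ^ (\<Delta> * card (S C)) * (1 / real N) ^ card (S C))" for C
  have total: "sum wt ?K \<le> 3 * real N"
    unfolding wt_def N_def
  proof (rule rooted_cover_weight)
    show "?V \<noteq> {}" using Npos by (auto simp: N_def)
    show "\<Delta> \<ge> 1" using d dn by (simp add: \<Delta>_def)
    show "card {y \<in> ?V. adj x y} \<le> \<Delta>" if "x \<in> ?V" for x using degree_le[OF that] by (simp add: \<Delta>_def)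
    show "C \<subseteq> ?V \<and> S C \<subseteq> C \<and> r C \<in> C \<and> (\<forall>c\<in>C. connected_in adj {c} C)" if "C \<in> ?K" for C
      using Sr[OF that] that by (auto simp: clusters_def)
  qed (auto simp: W_def)
  have each: "avoid_prob d n m (cob n d C) \<le> real n powr (- 1 / 8) / real N * wt C" if C: "C \<in> ?K" for C
  proof -
    define k u s b where "k = card C" and "u = card (C - W C)" and "s = card (S C)" and "b = card (cob n d C)"
    have CK: "C \<subseteq> ?V" and k2: "2 \<le> k" and expand: "n * k \<le> (d + 1) * b"
      using C by (auto simp: clusters_def k_def b_def)
    have finC: "finite C" using CK ksets_finite finite_subset by blast
    have finS: "finite (S C)" using Sr[OF C] finC finite_subset by blast
    have uk: "u \<le> k" unfolding u_def k_def using finC by (intro card_mono) auto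
    have stk: "s * t \<le> k" using Sr[OF C] by (simp add: s_def k_def)
    have exponent: "1 / 8 + real u + real d + real k / (16 * (real d + 1)) \<le> c * real b / real n"
      unfolding c_def
    proof (rule cluster_exponent[OF d n t1(3,2) n2 k2 uk stk expand])
      assume "s = 0"
      hence S0: "S C = {}" using finS by (simp add: s_def)
      hence "W C = {r C}" by (simp add: W_def)
      hence "u = k - 1" using Sr[OF C] by (simp add: u_def k_def card_Diff_singleton)
      thus "u + 1 = k \<and> k * (n - d) \<le> b + t * k" using Sr[OF C] S0 k2 by (simp add: k_def b_def)
    next
      assume "s > 0"
      hence "S C \<noteq> {}" by (auto simp: s_def)
      hence "W C = {c\<in>C. \<exists>s\<in>S C. adj s c}" using Sr[OF C] by (auto simp: W_def)
      thus "u * (n - d) \<le> b + t * k" using Sr[OF C] by (simp add: u_def b_def k_def)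
    qed
    have "avoid_prob d n m (cob n d C) \<le> exp (- real b * real m / real T)"
      unfolding b_def T_def by (rule avoid_prob_le) (use cob_subset m in \<open>auto simp: T_def\<close>)
    also have "\<dots> \<le> exp (- (c * real b / real n) * ln (real n))"
    proof -
      have "real b * (c * real T * ln (real n) / real n) / real T \<le> real b * real m / real T"
        using m(2) Tpos by (intro divide_right_mono mult_left_mono) auto
      thus ?thesis using Tpos by (simp add: field_simps)
    qed
    also have "\<dots> \<le> exp (- (1 / 8 + real u + real d + real k / (16 * (real d + 1))) * ln (real n))"
      using mult_right_mono[OF exponent, of "ln (real n)"] npos
      by (simp only: exp_le_cancel_iff mult_minus_left neg_le_iff_le) simp
    also have "\<dots> \<le> exp (ln (real n powr (- 1 / 8) / real N * wt C))"
    proof -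
      have L: "ln (real n) > 0" using npos by simp
      have "real s * real t \<le> real k" using stk by (simp flip: of_nat_mult)
      hence "real s * (real n / (16 * real d)) \<le> real k"
        using mult_left_mono[OF t1(2), of "real s"] by linarith
      hence sn: "real s * real n \<le> 16 * real d * real k" using d by (simp add: field_simps)
      have lnN: "ln (real N) \<le> real d * ln (real n)"
      proof -
        have "ln (real N) \<le> ln (real n ^ d)" using Nle Npos npos by (subst ln_le_cancel_iff) auto
        thus ?thesis using npos by (simp add: ln_realpow)
      qed
      have lnwt: "ln (wt C) = - real u * ln (2 * real \<Delta>) - real k * ln 2 - real \<Delta> * real s * ln 2 - real s * ln (real N)"
      proof -
        have "\<Delta> > 0" using d dn by (simp add: \<Delta>_def)
        thus ?thesis unfolding wt_def using Npos
          by (simp add: ln_mult ln_realpow ln_div u_def k_def s_def algebra_simps)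
      qed
      have wtpos: "wt C > 0" using d dn Npos by (simp add: wt_def \<Delta>_def)
      have ln\<Delta>: "ln (2 * real \<Delta>) = ln (2 * real d) + ln (real n)"
        using d npos by (simp add: \<Delta>_def ln_mult)
      define P where "P = 16 * (real d)\<^sup>2 * ln 2"
      define Q where "Q = 16 * (real d)\<^sup>2 * ln (real n) / real n"
      define R where "R = ln (real n) / (16 * (real d + 1))"
      have 1: "real u * ln (2 * real d) \<le> real k * ln (2 * real d)"
        using uk d by (intro mult_right_mono) auto
      have 2: "real \<Delta> * real s * ln 2 \<le> real k * P"
        using mult_left_mono[OF sn, of "real d * ln 2"] by (simp add: \<Delta>_def P_def power2_eq_square mult_ac)
      have 3: "real s * ln (real N) \<le> real k * Q"
      proof -
        have "real s * ln (real N) \<le> real s * (real d * ln (real n))" using lnN by (intro mult_left_mono) auto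
        also have "\<dots> = (real s * real n) * (real d * ln (real n) / real n)" using npos by simp
        also have "\<dots> \<le> (16 * real d * real k) * (real d * ln (real n) / real n)"
          using sn L npos by (intro mult_right_mono) auto
        also have "\<dots> = real k * Q" by (simp add: Q_def power2_eq_square)
        finally show ?thesis .
      qed
      have 4: "real k * (ln (2 * real d) + ln 2 + P + Q) \<le> real k * R"
        unfolding P_def Q_def R_def using ln by (intro mult_left_mono) auto
      have 5: "real u * ln (2 * real \<Delta>) = real u * ln (2 * real d) + real u * ln (real n)"
        unfolding ln\<Delta> by (rule distrib_left)
      have 6: "real k / (16 * (real d + 1)) * ln (real n) = real k * R" by (simp add: R_def)
      have "ln (real n powr (- 1 / 8) / real N * wt C) = - 1 / 8 * ln (real n) - ln (real N) + ln (wt C)"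
        using wtpos Npos npos by (simp add: ln_mult ln_div ln_powr)
      hence "- (1 / 8 + real u + real d + real k / (16 * (real d + 1))) * ln (real n)
          \<le> ln (real n powr (- 1 / 8) / real N * wt C)"
        using 1 2 3 4 5 6 lnwt lnN by (simp only: distrib_left distrib_right mult_minus_left)
      thus ?thesis by simp
    qed
    also have "\<dots> = real n powr (- 1 / 8) / real N * wt C"
      using d dn Npos npos by (intro exp_ln) (simp add: wt_def \<Delta>_def)
    finally show ?thesis .
  qed
  have "(\<Sum>C\<in>?K. avoid_prob d n m (cob n d C)) \<le> (\<Sum>C\<in>?K. real n powr (- 1 / 8) / real N * wt C)"
    by (rule sum_mono) (rule each)
  also have "\<dots> = real n powr (- 1 / 8) / real N * sum wt ?K" by (simp add: sum_distrib_left)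
  also have "\<dots> \<le> real n powr (- 1 / 8) / real N * (3 * real N)" using total by (intro mult_left_mono) auto
  also have "\<dots> = 3 * real n powr (- 1 / 8)" using Npos by simp
  finally show ?thesis .
qed

section \<open>An isolated face is still present\<close>

text \<open>
  Chebyshev's inequality: on the event \<open>X = 0\<close>, the squared deviation of \<open>X\<close> is the square of its
  expectation.
\<close>

lemma second_moment:
  fixes X :: "'a \<Rightarrow> real"
  assumes fin: "finite (set_pmf p)" and pos: "measure_pmf.expectation p X > 0"
  shows "measure_pmf.prob p {x. X x = 0} \<le>
    measure_pmf.expectation p (\<lambda>x. (X x)\<^sup>2) / (measure_pmf.expectation p X)\<^sup>2 - 1"
proof -
  define \<mu> where "\<mu> = measure_pmf.expectation p X"
  have int: "integrable (measure_pmf p) f" for f :: "'a \<Rightarrow> real"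
    using fin by (rule integrable_measure_pmf_finite)
  have "\<mu>\<^sup>2 * measure_pmf.prob p {x. X x = 0} = measure_pmf.expectation p (\<lambda>x. \<mu>\<^sup>2 * indicator {x. X x = 0} x)"
    by simp
  also have "\<dots> \<le> measure_pmf.expectation p (\<lambda>x. (X x)\<^sup>2 - 2 * \<mu> * X x + \<mu>\<^sup>2)"
  proof (rule integral_mono[OF int int])
    fix x
    have "(X x)\<^sup>2 - 2 * \<mu> * X x + \<mu>\<^sup>2 = (X x - \<mu>)\<^sup>2" by (simp add: power2_diff)
    thus "\<mu>\<^sup>2 * indicator {x. X x = 0} x \<le> (X x)\<^sup>2 - 2 * \<mu> * X x + \<mu>\<^sup>2"
      by (cases "X x = 0") auto
  qed
  also have "\<dots> = measure_pmf.expectation p (\<lambda>x. (X x)\<^sup>2) - 2 * \<mu> * \<mu> + \<mu>\<^sup>2"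
    using int by (simp add: \<mu>_def)
  finally have "\<mu>\<^sup>2 * measure_pmf.prob p {x. X x = 0} \<le> measure_pmf.expectation p (\<lambda>x. (X x)\<^sup>2) - \<mu>\<^sup>2"
    by (simp add: power2_eq_square)
  moreover have "\<mu>\<^sup>2 > 0" using pos by (simp add: \<mu>_def)
  ultimately show ?thesis by (simp add: \<mu>_def[symmetric] field_simps)
qed

text \<open>
  The second moment method for the number \<open>X\<close> of isolated faces. Pairs of non-adjacent faces have no
  common coface and contribute at most the square of the expectation. What remains are the diagonal,
  giving \<open>1 / (N q)\<close>, and the adjacent pairs, which are rare among all pairs.
\<close>

lemma no_isolated_prob:
  fixes d n m :: nat
  defines "T \<equiv> n choose (d + 1)" and "N \<equiv> n choose d"
  assumes m: "m < T" and small: "4 * (n - d) * (n - d) \<le> T - m"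
    and N: "N > 0" and q: "q > 0"
    and q_eq: "\<And>a. a \<in> ksets n d \<Longrightarrow> avoid_prob d n m {s \<in> ksets n (Suc d). a \<subseteq> s} = q"
  shows "measure_pmf.prob (random_faces d n m) {fs. uncovered n d (set fs) = {}}
    \<le> 1 / (real N * q) + real (d * n) * (1 + 2 / real (T - m)) ^ m / real N"
proof -
  let ?p = "random_faces d n m" and ?V = "ksets n d"
  define cof where "cof a = {s \<in> ksets n (Suc d). a \<subseteq> s}" for a
  define I where "I a fs = indicat_real {fs. set fs \<inter> cof a = {}} fs" for a fs
  define X where "X fs = (\<Sum>a\<in>?V. I a fs)" for fs
  define y where "y = (1 + 2 / real (T - m)) ^ m"
  have mT: "m \<le> n choose (d + 1)" using m by (simp add: T_def)
  have fin: "finite (set_pmf ?p)" using mT by (rule finite_set_random_faces)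
  have int: "integrable (measure_pmf ?p) f" for f :: "_ \<Rightarrow> real"
    using fin by (rule integrable_measure_pmf_finite)
  have cof_sub: "cof a \<subseteq> ksets n (Suc d)" for a by (auto simp: cof_def)
  have cV: "card ?V = N" by (simp add: card_ksets N_def)
  have EI: "measure_pmf.expectation ?p (I a) = avoid_prob d n m (cof a)" for a
    by (simp add: I_def[abs_def] avoid_prob_def)
  have EX: "measure_pmf.expectation ?p X = real N * q"
  proof -
    have "measure_pmf.expectation ?p X = (\<Sum>a\<in>?V. measure_pmf.expectation ?p (I a))"
      unfolding X_def by (rule Bochner_Integration.integral_sum) (rule int)
    also have "\<dots> = (\<Sum>a\<in>?V. q)" using q_eq by (intro sum.cong) (auto simp: EI cof_def)
    finally show ?thesis using cV by simp
  qed
  have EII: "measure_pmf.expectation ?p (\<lambda>fs. I a fs * I b fs) = avoid_prob d n m (cof a \<union> cof b)" for a b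
  proof -
    have "(\<lambda>fs. I a fs * I b fs) = indicator {fs. set fs \<inter> (cof a \<union> cof b) = {}}"
      by (auto simp: I_def fun_eq_iff Int_Un_distrib split: split_indicator)
    thus ?thesis by (simp add: avoid_prob_def)
  qed
  have pair: "avoid_prob d n m (cof a \<union> cof b) \<le> (if a = b then q else if adj a b then q * q * y else q * q)"
    if ab: "a \<in> ?V" "b \<in> ?V" for a b
  proof (cases "a = b")
    case True
    thus ?thesis using q_eq[OF ab(1)] by (simp add: cof_def)
  next
    case False
    define i where "i = (if adj a b then 1 else 0 :: nat)"
    have inter: "s = a \<union> b \<and> adj a b" if "s \<in> cof a \<inter> cof b" for s
      using facets_adj[of s n d a b] that ab False by (auto simp: cof_def)
    have "card (cof a \<inter> cof b) \<le> i"
    proof (cases "adj a b")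
      case True
      have "cof a \<inter> cof b \<subseteq> {a \<union> b}" using inter by blast
      hence "card (cof a \<inter> cof b) \<le> card {a \<union> b}" by (intro card_mono) auto
      thus ?thesis using True by (simp add: i_def)
    next
      case False
      hence "cof a \<inter> cof b = {}" using inter by blast
      thus ?thesis by simp
    qed
    hence "avoid_prob d n m (cof a \<union> cof b) \<le> avoid_prob d n m (cof a) * avoid_prob d n m (cof b)
        * (1 + 2 * real i / real ((n choose (d + 1)) - m)) ^ m"
      using card_cofaces[OF ab(1)] card_cofaces[OF ab(2)] small m
      by (intro avoid_prob_Un_le[where a = "n - d"] cof_sub mT) (auto simp: cof_def T_def i_def)
    also have "\<dots> = q * q * (1 + 2 * real i / real (T - m)) ^ m"
      using q_eq[OF ab(1)] q_eq[OF ab(2)] by (simp add: cof_def T_def)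
    also have "\<dots> = (if adj a b then q * q * y else q * q)" by (simp add: i_def y_def)
    finally show ?thesis using False by simp
  qed
  have y1: "y \<ge> 0" unfolding y_def by simp
  have row: "(\<Sum>b\<in>?V. avoid_prob d n m (cof a \<union> cof b)) \<le> q + real (d * n) * (q * q * y) + real N * (q * q)"
    if a: "a \<in> ?V" for a
  proof -
    have "(\<Sum>b\<in>?V. avoid_prob d n m (cof a \<union> cof b)) \<le>
        (\<Sum>b\<in>?V. (if b = a then q else 0) + (if adj a b then q * q * y else 0) + q * q)"
    proof (rule sum_mono)
      fix b assume b: "b \<in> ?V"
      have nonneg: "0 \<le> q * q" "0 \<le> q * q * y" using q y1 by auto
      show "avoid_prob d n m (cof a \<union> cof b) \<le> (if b = a then q else 0) + (if adj a b then q * q * y else 0) + q * q"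
      proof (cases "a = b")
        case True
        hence "avoid_prob d n m (cof a \<union> cof b) \<le> (if b = a then q else 0)" using pair[OF a b] by simp
        moreover have "0 \<le> (if adj a b then q * q * y else 0)" using nonneg by simp
        ultimately show ?thesis using nonneg(1) by linarith
      next
        case False
        thus ?thesis using pair[OF a b] by (cases "adj a b") (simp_all add: add_increasing2)
      qed
    qed
    also have "\<dots> = q + real (card {b\<in>?V. adj a b}) * (q * q * y) + real N * (q * q)"
      using a by (simp add: sum.distrib sum.If_cases Int_def cV)
    also have "\<dots> \<le> q + real (d * n) * (q * q * y) + real N * (q * q)"
      using degree_le[OF a] q y1 by (intro add_mono mult_right_mono order_refl) (auto simp flip: of_nat_mult)
    finally show ?thesis .
  qed
  have "measure_pmf.expectation ?p (\<lambda>fs. (X fs)\<^sup>2) =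
      measure_pmf.expectation ?p (\<lambda>fs. \<Sum>a\<in>?V. \<Sum>b\<in>?V. I a fs * I b fs)"
    by (simp add: X_def power2_eq_square sum_product)
  also have "\<dots> = (\<Sum>a\<in>?V. measure_pmf.expectation ?p (\<lambda>fs. \<Sum>b\<in>?V. I a fs * I b fs))"
    by (rule Bochner_Integration.integral_sum) (rule int)
  also have "\<dots> = (\<Sum>a\<in>?V. \<Sum>b\<in>?V. measure_pmf.expectation ?p (\<lambda>fs. I a fs * I b fs))"
    by (rule sum.cong[OF refl], rule Bochner_Integration.integral_sum, rule int)
  also have "\<dots> = (\<Sum>a\<in>?V. \<Sum>b\<in>?V. avoid_prob d n m (cof a \<union> cof b))" by (simp only: EII)
  also have "\<dots> \<le> (\<Sum>a\<in>?V. q + real (d * n) * (q * q * y) + real N * (q * q))"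
    by (rule sum_mono) (rule row)
  also have "\<dots> = real N * (q + real (d * n) * (q * q * y) + real N * (q * q))" by (simp add: cV)
  finally have EX2: "measure_pmf.expectation ?p (\<lambda>fs. (X fs)\<^sup>2) \<le> \<dots>" .
  have "{fs. uncovered n d (set fs) = {}} \<inter> set_pmf ?p \<subseteq> {fs. X fs = 0}"
  proof
    fix fs assume fs: "fs \<in> {fs. uncovered n d (set fs) = {}} \<inter> set_pmf ?p"
    have sub: "set fs \<subseteq> ksets n (Suc d)" using set_random_faces[OF mT, of fs] fs by auto
    have "I a fs = 0" if a: "a \<in> ?V" for a
    proof -
      have "a \<notin> uncovered n d (set fs)" using fs by simp
      then obtain s where "s \<in> set fs" "a \<subseteq> s" using a by (auto simp: uncovered_def)
      hence "s \<in> set fs \<inter> cof a" using sub by (auto simp: cof_def)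
      hence "set fs \<inter> cof a \<noteq> {}" by blast
      thus ?thesis by (simp add: I_def)
    qed
    thus "fs \<in> {fs. X fs = 0}" by (simp add: X_def)
  qed
  hence "measure_pmf.prob ?p {fs. uncovered n d (set fs) = {}} \<le> measure_pmf.prob ?p {fs. X fs = 0}"
    by (intro measure_pmf.finite_measure_mono_AE) (auto simp: AE_measure_pmf_iff)
  also have "\<dots> \<le> measure_pmf.expectation ?p (\<lambda>fs. (X fs)\<^sup>2) / (measure_pmf.expectation ?p X)\<^sup>2 - 1"
    by (rule second_moment[OF fin]) (use EX N q in simp)
  also have "\<dots> \<le> real N * (q + real (d * n) * (q * q * y) + real N * (q * q)) / (real N * q)\<^sup>2 - 1"
    unfolding EX using EX2 by (intro diff_right_mono divide_right_mono) auto
  also have "\<dots> = 1 / (real N * q) + real (d * n) * y / real N"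
    using N q by (simp add: field_simps power2_eq_square)
  finally show ?thesis unfolding y_def .
qed

lemma choose_ge_power:
  assumes "j \<le> k" "1 \<le> k" "k \<le> n"
  shows "(real n / real k) ^ j \<le> real (n choose k)"
proof -
  have "(real n / real k) ^ j \<le> (real n / real k) ^ k"
    using assms by (intro power_increasing) (auto simp: field_simps)
  also have "\<dots> \<le> real (n choose k)" using binomial_ge_n_over_k_pow_k[of k n] assms by simp
  finally show ?thesis .
qed

text \<open>
  The true order is \<open>n powr (1 / 16 - d)\<close>. The margin between \<open>1 / 16\<close> and \<open>1 / 32\<close> absorbs the corrections
  for drawing without replacement, for which \<open>\<delta>\<close> is chosen such that \<open>3 \<delta> d = 1 / 32\<close>.
\<close>

lemma coface_avoid_ge:
  fixes d n m :: nat
  defines "T \<equiv> n choose (d + 1)" and "\<delta> \<equiv> 1 / (96 * real d)"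
  assumes d: "d \<ge> 2" and n: "d < n" and a: "a \<in> ksets n d"
    and m: "real m \<le> (real d - 1 / 16) * real T * ln (real n) / real n + 1" "real m \<le> \<delta> * real T"
    and nT: "real n \<le> \<delta> / 2 * real T"
  shows "exp (- 1) * real n powr (1 / 32 - real d) \<le> avoid_prob d n m {s \<in> ksets n (Suc d). a \<subseteq> s}"
proof -
  define x where "x = real n / ((1 - \<delta>) * real T)"
  define L where "L = ln (real n)"
  have "1 / (96 * real d) \<le> 1 / (96 * 2)" using d by (intro divide_left_mono) auto
  hence \<delta>: "0 < \<delta>" "\<delta> \<le> 1 / 192" "3 * \<delta> * real d = 1 / 32" using d by (simp_all add: \<delta>_def)
  have n1: "real n > 1" using n d by simp
  have L: "L > 0" using n1 by (simp add: L_def)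
  have Tpos: "real T > 0" using n by (simp add: T_def)
  have mT: "m < T"
  proof -
    have "\<delta> * real T \<le> (1 / 2) * real T" using \<delta> Tpos by (intro mult_right_mono) auto
    hence "real m < real T" using m(2) Tpos by linarith
    thus ?thesis by simp
  qed
  have Tm: "real (T - m) \<ge> (1 - \<delta>) * real T" using m(2) mT by (simp add: of_nat_diff algebra_simps)
  have pos: "(1 - \<delta>) * real T > 0" using \<delta> Tpos by simp
  have x0: "x \<ge> 0" using pos by (simp add: x_def)
  have x\<delta>: "x \<le> \<delta>"
  proof -
    have "\<delta> / 2 * real T \<le> \<delta> * (1 - \<delta>) * real T" using \<delta> Tpos by (intro mult_right_mono) auto
    hence "real n \<le> \<delta> * ((1 - \<delta>) * real T)" using nT by (simp add: mult.assoc)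
    thus ?thesis unfolding x_def using pos by (simp add: pos_divide_le_eq)
  qed
  have card: "card {s \<in> ksets n (Suc d). a \<subseteq> s} = n - d" by (rule card_cofaces[OF a])
  have "real (n - d) / real (T - m) \<le> real n / ((1 - \<delta>) * real T)"
    using Tm pos by (intro frac_le) auto
  hence "(1 - x) ^ m \<le> avoid_prob d n m {s \<in> ksets n (Suc d). a \<subseteq> s}"
    using mT x\<delta> \<delta> card by (intro avoid_prob_ge) (auto simp: T_def x_def)
  moreover have "exp (- (x / (1 - \<delta>))) ^ m \<le> (1 - x) ^ m"
  proof (rule power_mono)
    have "x / (1 - x) \<le> x / (1 - \<delta>)" using x0 x\<delta> \<delta> by (intro frac_le) auto
    moreover have "1 + x / (1 - x) \<le> exp (x / (1 - x))" by (rule exp_ge_add_one_self)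
    moreover have "exp (x / (1 - x)) \<le> exp (x / (1 - \<delta>))" using calculation(1) by simp
    moreover have "1 + x / (1 - x) = 1 / (1 - x)" using x\<delta> \<delta> by (simp add: field_simps)
    ultimately have le: "1 / (1 - x) \<le> exp (x / (1 - \<delta>))" by linarith
    have "1 - x > 0" using x\<delta> \<delta> by linarith
    hence "1 / exp (x / (1 - \<delta>)) \<le> 1 - x" using le by (simp add: pos_divide_le_eq mult.commute)
    thus "exp (- (x / (1 - \<delta>))) \<le> 1 - x" by (simp add: exp_minus inverse_eq_divide)
  qed simp
  moreover have "exp (- 1) * real n powr (1 / 32 - real d) \<le> exp (- (x / (1 - \<delta>))) ^ m"
  proof -
    have sq: "1 / (1 - \<delta>)\<^sup>2 \<le> 1 + 3 * \<delta>"
    proof -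
      have "(1 + 3 * \<delta>) * (1 - \<delta>)\<^sup>2 - 1 = \<delta> * (1 - 5 * \<delta> + 3 * \<delta>\<^sup>2)"
        by (simp add: power2_eq_square algebra_simps)
      also have "\<dots> \<ge> 0" using \<delta> by (intro mult_nonneg_nonneg add_nonneg_nonneg) auto
      finally have "1 \<le> (1 + 3 * \<delta>) * (1 - \<delta>)\<^sup>2" by simp
      moreover have "(1 - \<delta>)\<^sup>2 > 0" using \<delta> by simp
      ultimately show ?thesis by (simp add: pos_divide_le_eq)
    qed
    have "real m * (x / (1 - \<delta>)) \<le> ((real d - 1 / 16) * real T * L / real n + 1) * (x / (1 - \<delta>))"
      using m(1) x0 \<delta> by (intro mult_right_mono) (auto simp: L_def)
    also have "\<dots> = ((real d - 1 / 16) * L + real n / real T) * (1 / (1 - \<delta>)\<^sup>2)"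
    proof -
      define e where "e = 1 - \<delta>"
      have "e > 0" using \<delta> by (simp add: e_def)
      thus ?thesis unfolding x_def e_def[symmetric] using n1 Tpos
        by (simp add: field_simps power2_eq_square)
    qed
    also have "\<dots> \<le> ((real d - 1 / 16) * L + \<delta>) * (1 + 3 * \<delta>)"
    proof (intro mult_mono add_left_mono sq)
      have "real n / real T \<le> \<delta> / 2" using nT Tpos by (simp add: pos_divide_le_eq)
      thus "real n / real T \<le> \<delta>" using \<delta>(1) by linarith
      show "0 \<le> (real d - 1 / 16) * L + \<delta>" using d L \<delta> by (intro add_nonneg_nonneg mult_nonneg_nonneg) auto
    qed simp
    also have "\<dots> \<le> (real d - 1 / 32) * L + 1"
    proof -
      have "(real d - 1 / 16) * L * (3 * \<delta>) \<le> real d * L * (3 * \<delta>)"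
        using L \<delta> by (intro mult_right_mono) auto
      also have "\<dots> = 1 / 32 * L" using \<delta>(3) by (simp add: algebra_simps)
      finally have B: "(real d - 1 / 16) * L * (3 * \<delta>) \<le> 1 / 32 * L" .
      have "\<delta> * (1 + 3 * \<delta>) \<le> (1 / 2) * 2" using \<delta> by (intro mult_mono) auto
      hence C: "\<delta> * (1 + 3 * \<delta>) \<le> 1" by simp
      have "((real d - 1 / 16) * L + \<delta>) * (1 + 3 * \<delta>) =
          (real d - 1 / 16) * L + (real d - 1 / 16) * L * (3 * \<delta>) + \<delta> * (1 + 3 * \<delta>)"
        by (simp add: algebra_simps)
      also have "\<dots> \<le> (real d - 1 / 16) * L + 1 / 32 * L + 1"
        by (rule add_mono[OF add_left_mono[OF B] C])
      also have "\<dots> = (real d - 1 / 32) * L + 1" by (simp add: algebra_simps)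
      finally show ?thesis .
    qed
    finally have "exp (- ((real d - 1 / 32) * L + 1)) \<le> exp (- (real m * (x / (1 - \<delta>))))"
      by (simp only: exp_le_cancel_iff neg_le_iff_le)
    moreover have "exp (- ((real d - 1 / 32) * L + 1)) = exp (- 1) * real n powr (1 / 32 - real d)"
      using n1 by (simp add: powr_def L_def exp_add[symmetric] algebra_simps)
    moreover have "exp (- (real m * (x / (1 - \<delta>)))) = exp (- (x / (1 - \<delta>))) ^ m"
      by (simp add: exp_of_nat_mult[symmetric])
    ultimately show ?thesis by (simp only:)
  qed
  ultimately show ?thesis by linarith
qed

text \<open>
  There are at least \<open>(n / d) ^ d\<close> faces, so the expected number of isolated ones is at least of order
  \<open>n powr (1 / 32)\<close>, and a face is adjacent to a fraction of order at most \<open>1 / n\<close> of all faces, as \<open>d \<ge> 2\<close>.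
\<close>

lemma no_isolated_prob_bound:
  fixes d n m :: nat
  defines "T \<equiv> n choose (d + 1)" and "\<delta> \<equiv> 1 / (96 * real d)"
  assumes d: "d \<ge> 2" and n: "192 * real d * (real d + 1) ^ 3 \<le> real n"
    and m: "real m \<le> (real d - 1 / 16) * real T * ln (real n) / real n + 1" "real m \<le> \<delta> * real T"
    and nT: "real n \<le> \<delta> / 2 * real T"
  shows "measure_pmf.prob (random_faces d n m) {fs. uncovered n d (set fs) = {}}
    \<le> exp 1 * real d ^ d * real n powr (- 1 / 32) + exp 1 * real d ^ 3 / real n"
proof -
  define N where "N = n choose d"
  (* T is at least of order n ^ 3 because d + 1 is at least 3; this dominates the squared number of
     cofaces of a face. *)
  define D where "D = real d + 1"
  have D: "D \<ge> 3" using d by (simp add: D_def)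
  have "1 / (96 * real d) \<le> 1 / (96 * 2)" using d by (intro divide_left_mono) auto
  hence \<delta>: "0 < \<delta>" "\<delta> \<le> 1 / 192" using d by (simp_all add: \<delta>_def)
  have nD3: "192 * D ^ 3 \<le> real n"
  proof -
    have "192 * 1 * D ^ 3 \<le> 192 * real d * D ^ 3" using d D by (intro mult_mono) auto
    moreover have "192 * real d * D ^ 3 \<le> real n" using n by (simp only: D_def)
    ultimately show ?thesis by linarith
  qed
  have "D \<le> D ^ 3" using D power_increasing[of 1 3 D] by simp
  hence "D < 192 * D ^ 3" using D by linarith
  hence Dn: "D < real n" using nD3 by linarith
  hence dn: "d < n" by (simp add: D_def)
  have n1: "real n > 1" using Dn D by linarith
  have Tpos: "real T > 0" using dn by (simp add: T_def)
  have Npos: "N > 0" using dn by (simp add: N_def)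
  have mT: "m < T"
  proof -
    have "\<delta> * real T \<le> (1 / 2) * real T" using \<delta> Tpos by (intro mult_right_mono) auto
    hence "real m < real T" using m(2) Tpos by linarith
    thus ?thesis by simp
  qed
  have Tm: "real (T - m) \<ge> (1 - \<delta>) * real T" using m(2) mT by (simp add: of_nat_diff algebra_simps)
  have T3: "(real n / D) ^ 3 \<le> real T"
    using choose_ge_power[of 3 "d + 1" n] d dn by (simp add: T_def D_def add.commute)
  have small: "4 * (n - d) * (n - d) \<le> T - m"
  proof -
    have "192 \<le> real n / D ^ 3" using nD3 D by (simp add: field_simps)
    hence "192 * (real n)\<^sup>2 \<le> real n / D ^ 3 * (real n)\<^sup>2" by (intro mult_right_mono) auto
    also have "\<dots> = (real n / D) ^ 3" by (simp add: power_divide power3_eq_cube power2_eq_square)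
    finally have "192 * (real n)\<^sup>2 \<le> real T" using T3 by linarith
    moreover have "(1 / 2) * real T \<le> (1 - \<delta>) * real T" using \<delta> Tpos by (intro mult_right_mono) auto
    ultimately have "4 * (real n)\<^sup>2 \<le> real (T - m)" using Tm by linarith
    moreover have "real (4 * (n - d) * (n - d)) \<le> 4 * (real n)\<^sup>2"
    proof -
      have "real (n - d) * real (n - d) \<le> real n * real n" by (intro mult_mono) auto
      thus ?thesis by (simp add: power2_eq_square)
    qed
    ultimately have "real (4 * (n - d) * (n - d)) \<le> real (T - m)" by linarith
    thus ?thesis by (simp only: of_nat_le_iff)
  qed
  obtain a0 where a0: "a0 \<in> ksets n d"
    using Npos by (metis N_def card.empty card_ksets equals0I less_irrefl)
  define q where "q = avoid_prob d n m {s \<in> ksets n (Suc d). a0 \<subseteq> s}"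
  have q_eq: "avoid_prob d n m {s \<in> ksets n (Suc d). a \<subseteq> s} = q" if "a \<in> ksets n d" for a
    unfolding q_def using card_cofaces[OF that] card_cofaces[OF a0] mT
    by (intro avoid_prob_cong_card) (auto simp: T_def)
  have q_ge: "exp (- 1) * real n powr (1 / 32 - real d) \<le> q"
    unfolding q_def using coface_avoid_ge[OF d dn a0, of m] m nT by (simp add: T_def \<delta>_def)
  moreover have "exp (- 1) * real n powr (1 / 32 - real d) > 0" using n1 by simp
  ultimately have q: "q > 0" by linarith
  have "measure_pmf.prob (random_faces d n m) {fs. uncovered n d (set fs) = {}}
    \<le> 1 / (real N * q) + real (d * n) * (1 + 2 / real (T - m)) ^ m / real N"
    unfolding N_def T_def using mT small Npos q q_eq
    by (intro no_isolated_prob) (auto simp: T_def N_def)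
  also have "1 / (real N * q) \<le> exp 1 * real d ^ d * real n powr (- 1 / 32)"
  proof -
    have "(real n / real d) ^ d * (exp (- 1) * real n powr (1 / 32 - real d)) \<le> real N * q"
      using choose_ge_power[of d d n] d dn q_ge by (intro mult_mono) (auto simp: N_def)
    moreover have "(real n / real d) ^ d * (exp (- 1) * real n powr (1 / 32 - real d)) =
        real n powr (1 / 32) / (exp 1 * real d ^ d)"
    proof -
      have "real n ^ d * real n powr (1 / 32 - real d) = real n powr (1 / 32)"
        using n1 by (simp add: powr_realpow[symmetric] powr_add[symmetric])
      thus ?thesis by (simp add: power_divide exp_minus field_simps)
    qed
    ultimately have "real n powr (1 / 32) / (exp 1 * real d ^ d) \<le> real N * q" by simp
    moreover have "real n powr (1 / 32) / (exp 1 * real d ^ d) > 0" using n1 d by simp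
    ultimately have "1 / (real N * q) \<le> 1 / (real n powr (1 / 32) / (exp 1 * real d ^ d))"
      using Npos q by (intro divide_left_mono mult_pos_pos) auto
    also have "\<dots> = exp 1 * real d ^ d * real n powr (- 1 / 32)"
      using n1 powr_minus[of "real n" "1 / 32"] by (simp add: field_simps)
    finally show ?thesis .
  qed
  also have "real (d * n) * (1 + 2 / real (T - m)) ^ m / real N \<le> exp 1 * real d ^ 3 / real n"
  proof -
    have Tm2: "real (T - m) \<ge> real T / 2"
    proof -
      have "(1 / 2) * real T \<le> (1 - \<delta>) * real T" using \<delta> Tpos by (intro mult_right_mono) auto
      thus ?thesis using Tm by linarith
    qed
    have "(1 + 2 / real (T - m)) ^ m \<le> exp (2 / real (T - m)) ^ m"
      using exp_ge_add_one_self[of "2 / real (T - m)"] by (intro power_mono) auto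
    also have "\<dots> = exp (real m * (2 / real (T - m)))" by (simp add: exp_of_nat_mult[symmetric])
    also have "\<dots> \<le> exp 1"
    proof -
      have "2 * real m \<le> real (T - m)" 
      proof -
        have "\<delta> * real T \<le> (1 / 4) * real T" using \<delta> Tpos by (intro mult_right_mono) auto
        thus ?thesis using m(2) Tm2 by linarith
      qed
      hence "real m * (2 / real (T - m)) \<le> 1" using mT by (simp add: field_simps)
      thus ?thesis by simp
    qed
    finally have y: "(1 + 2 / real (T - m)) ^ m \<le> exp 1" .
    have N2: "(real n / real d)\<^sup>2 \<le> real N" using choose_ge_power[of 2 d n] d dn by (simp add: N_def)
    have "real (d * n) * (1 + 2 / real (T - m)) ^ m / real N \<le> real (d * n) * exp 1 / (real n / real d)\<^sup>2"
      using y N2 n1 d by (intro frac_le mult_left_mono) auto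
    also have "\<dots> = exp 1 * real d ^ 3 / real n"
      using n1 d by (simp add: field_simps power2_eq_square power3_eq_cube)
    finally show ?thesis .
  qed
  finally show ?thesis by simp
qed

section \<open>The limit\<close>

text \<open>
  The number of steps \<open>m\<close> is just large enough for \<open>cluster_sum_bound\<close>; the hypotheses on \<open>n\<close> make it a small
  fraction of the number \<open>T\<close> of all faces.
\<close>

lemma agreement_prob_ge:
  fixes d n :: nat
  assumes d: "d \<ge> 2" and n: "192 * real d * (real d + 1) ^ 3 \<le> real n"
    and ln_small: "ln (real n) / real n \<le> 1 / (192 * (real d)\<^sup>2)"
    and ln_big: "16 * (real d + 1) * (ln (2 * real d) + ln 2 + 16 * (real d)\<^sup>2 * ln 2 + 1) \<le> ln (real n)"
  shows "1 - 3 * real n powr (- 1 / 8) - exp 1 * real d ^ d * real n powr (- 1 / 32) - exp 1 * real d ^ 3 / real n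
    \<le> measure_pmf.prob (face_process d n) {fs. M1 d n fs = M2 d n fs}"
proof -
  define D where "D = real d"
  define T where "T = n choose (d + 1)"
  define \<delta> where "\<delta> = 1 / (96 * D)"
  define m where "m = nat \<lceil>(D - 1 / 16) * real T * ln (real n) / real n\<rceil>"
  have D: "D \<ge> 2" using d by (simp add: D_def)
  have nD: "192 * D * (D + 1) ^ 3 \<le> real n" using n by (simp only: D_def)
  have D12: "3 \<le> D + 1" "(D + 1)\<^sup>2 \<ge> 1" "D + 1 \<le> (D + 1)\<^sup>2" "(D + 1) ^ 3 = (D + 1) * (D + 1)\<^sup>2"
    using D power_increasing[of 1 2 "D + 1"] power_increasing[of 0 2 "D + 1"]
    by (auto simp: power3_eq_cube power2_eq_square)
  have D3: "D * ((D + 1) * (D + 1)\<^sup>2) \<ge> D * (3 * (D + 1)\<^sup>2)"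
    using D D12 by (intro mult_left_mono mult_right_mono) auto
  hence n_a: "576 * (D * (D + 1)\<^sup>2) \<le> real n" using nD unfolding D12(4) by (simp add: algebra_simps)
  have Dge: "D * (D + 1)\<^sup>2 \<ge> D * (D + 1)" "D * (D + 1)\<^sup>2 \<ge> 1 * (D + 1)\<^sup>2" "D * (D + 1) \<ge> D * 1"
    using D D12 by (auto intro!: mult_left_mono mult_right_mono)
  have n1: "16 * d * (d + 1) \<le> n"
  proof -
    have "16 * (D * (D + 1)) \<le> real n" using n_a Dge D by linarith
    hence "real (16 * d * (d + 1)) \<le> real n" by (simp add: D_def algebra_simps)
    thus ?thesis by (simp only: of_nat_le_iff)
  qed
  have n2: "64 * (real d + 1)\<^sup>2 * real d * 16 / 3 \<le> real n"
  proof -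
    have "64 * (D + 1)\<^sup>2 * D * 16 / 3 = 1024 / 3 * (D * (D + 1)\<^sup>2)" by simp
    also have "\<dots> \<le> 576 * (D * (D + 1)\<^sup>2)" using Dge D by (intro mult_right_mono) auto
    also note n_a
    finally show ?thesis unfolding D_def .
  qed
  have n3: "(d + 1)\<^sup>2 \<le> n"
  proof -
    have "(D + 1)\<^sup>2 \<le> real n" using n_a Dge D12 by linarith
    hence "real ((d + 1)\<^sup>2) \<le> real n" by (simp add: D_def add.commute)
    thus ?thesis by (simp only: of_nat_le_iff)
  qed
  have dn: "d + 1 \<le> n" "d < n" using n3 by (auto simp: power2_eq_square)
  have npos: "real n > 1" using dn d by simp
  define L where "L = ln (real n)"
  have L: "L > 0" using npos by (simp add: L_def)
  have Tpos: "real T > 0" using dn by (simp add: T_def)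
  have T3: "(real n / (D + 1)) ^ 3 \<le> real T"
    using choose_ge_power[of 3 "d + 1" n] d dn by (simp add: T_def D_def add.commute)
  have \<delta>: "\<delta> > 0" "\<delta> \<le> 1" using D by (auto simp: \<delta>_def field_simps)
  have nT: "real n \<le> \<delta> / 2 * real T"
  proof -
    have pos: "(D + 1) ^ 3 > 0" using D by simp
    have "\<delta> / 2 * real n * real n / (D + 1) ^ 3 \<ge> 1"
    proof -
      have "1 * 1 \<le> (\<delta> / 2 * real n / (D + 1) ^ 3) * real n"
      proof (rule mult_mono)
        have "\<delta> / 2 * (192 * D * (D + 1) ^ 3) \<le> \<delta> / 2 * real n" using nD \<delta> by (intro mult_left_mono) auto
        moreover have "\<delta> / 2 * (192 * D * (D + 1) ^ 3) = (D + 1) ^ 3" using D by (simp add: \<delta>_def)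
        ultimately have "1 * (D + 1) ^ 3 \<le> \<delta> / 2 * real n" by (simp only: mult_1_left)
        thus "1 \<le> \<delta> / 2 * real n / (D + 1) ^ 3" by (simp only: pos_le_divide_eq[OF pos])
      qed (use npos \<delta> pos in auto)
      thus ?thesis by simp
    qed
    hence "1 * real n \<le> \<delta> / 2 * real n * real n / (D + 1) ^ 3 * real n" by (intro mult_right_mono) auto
    also have "\<dots> = \<delta> / 2 * (real n / (D + 1)) ^ 3" by (simp add: power_divide power3_eq_cube)
    also have "\<dots> \<le> \<delta> / 2 * real T" using T3 \<delta> by (intro mult_left_mono) auto
    finally show ?thesis by simp
  qed
  have arg_pos: "(D - 1 / 16) * real T * L / real n \<ge> 0" using D L by simp
  have m1: "(D - 1 / 16) * real T * L / real n \<le> real m" unfolding m_def L_def by (rule of_nat_ceiling)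
  have m2: "real m \<le> (D - 1 / 16) * real T * L / real n + 1"
    using arg_pos unfolding m_def L_def by linarith
  have m3: "real m \<le> \<delta> * real T"
  proof -
    have "(D - 1 / 16) * (L / real n) \<le> D * (1 / (192 * D\<^sup>2))"
      using ln_small L D npos by (intro mult_mono) (auto simp: L_def D_def)
    also have "\<dots> = \<delta> / 2" using D by (simp add: \<delta>_def power2_eq_square)
    finally have "(D - 1 / 16) * (L / real n) * real T \<le> \<delta> / 2 * real T"
      using Tpos by (intro mult_right_mono) auto
    moreover have "(D - 1 / 16) * real T * L / real n = (D - 1 / 16) * (L / real n) * real T" by simp
    ultimately show ?thesis using m2 nT npos by linarith
  qed
  have mT: "m \<le> T"
  proof -
    have "\<delta> * real T \<le> 1 * real T" using \<delta> Tpos by (intro mult_right_mono) auto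
    hence "real m \<le> real T" using m3 by linarith
    thus ?thesis by simp
  qed
  have "(\<Sum>C\<in>clusters n d. avoid_prob d n m (cob n d C)) \<le> 3 * real n powr (- 1 / 8)"
  proof (rule cluster_sum_bound[OF d n1 n2])
    have "16 * D\<^sup>2 * (L / real n) \<le> 16 * D\<^sup>2 * (1 / (192 * D\<^sup>2))"
      using ln_small by (intro mult_left_mono) (auto simp: L_def D_def)
    also have "\<dots> \<le> 1" using D by simp
    finally have "16 * D\<^sup>2 * L / real n \<le> 1" by simp
    hence "(ln (2 * D) + ln 2 + 16 * D\<^sup>2 * ln 2 + 16 * D\<^sup>2 * L / real n)
        \<le> (ln (2 * D) + ln 2 + 16 * D\<^sup>2 * ln 2 + 1)" by simp
    also have "\<dots> \<le> L / (16 * (D + 1))"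
      using ln_big D by (simp add: pos_le_divide_eq L_def D_def mult.commute)
    finally show "ln (2 * real d) + ln 2 + 16 * (real d)\<^sup>2 * ln 2 + 16 * (real d)\<^sup>2 * ln (real n) / real n
        \<le> ln (real n) / (16 * (real d + 1))" by (simp only: D_def L_def)
    show "m \<le> n choose (d + 1)" using mT by (simp add: T_def)
    show "(real d - 1 / 16) * real (n choose (d + 1)) * ln (real n) / real n \<le> real m"
      using m1 by (simp only: D_def L_def T_def)
  qed
  moreover have "measure_pmf.prob (random_faces d n m) {fs. uncovered n d (set fs) = {}}
    \<le> exp 1 * real d ^ d * real n powr (- 1 / 32) + exp 1 * real d ^ 3 / real n"
    by (rule no_isolated_prob_bound[OF d n])
      (use m2 m3 nT in \<open>simp_all only: D_def L_def T_def \<delta>_def\<close>)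
  moreover have "1 - (\<Sum>C\<in>clusters n d. avoid_prob d n m (cob n d C))
      - measure_pmf.prob (random_faces d n m) {fs. uncovered n d (set fs) = {}}
    \<le> measure_pmf.prob (face_process d n) {fs. M1 d n fs = M2 d n fs}"
    using mT by (intro hitting_times_prob d n3) (simp add: T_def)
  ultimately show ?thesis by linarith
qed

theorem corollary3p3:
  fixes d :: nat
  assumes "d \<ge> 2"
  shows "(\<lambda>n. measure_pmf.prob (face_process d n) {fs. M1 d n fs = M2 d n fs}) \<longlonglongrightarrow> 1"
proof (rule tendsto_sandwich)
  have ln_n: "(\<lambda>n. ln (real n) / real n) \<longlonglongrightarrow> 0" by real_asymp
  have ln_top: "filterlim (\<lambda>n. ln (real n)) at_top sequentially" by real_asymp
  have n_top: "filterlim (\<lambda>n. real n) at_top sequentially" by real_asymp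
  have "eventually (\<lambda>n. 192 * real d * (real d + 1) ^ 3 \<le> real n) sequentially"
    using n_top by (auto simp: filterlim_at_top)
  moreover have "eventually (\<lambda>n. ln (real n) / real n < 1 / (192 * (real d)\<^sup>2)) sequentially"
    using assms by (intro order_tendstoD(2)[OF ln_n]) auto
  moreover have "eventually (\<lambda>n. 16 * (real d + 1) * (ln (2 * real d) + ln 2 + 16 * (real d)\<^sup>2 * ln 2 + 1)
      \<le> ln (real n)) sequentially"
    using ln_top by (auto simp: filterlim_at_top)
  ultimately show "eventually (\<lambda>n. 1 - 3 * real n powr (- 1 / 8) - exp 1 * real d ^ d * real n powr (- 1 / 32)
      - exp 1 * real d ^ 3 / real n
    \<le> measure_pmf.prob (face_process d n) {fs. M1 d n fs = M2 d n fs}) sequentially"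
    by eventually_elim (rule agreement_prob_ge[OF assms], simp_all)
  show "eventually (\<lambda>n. measure_pmf.prob (face_process d n) {fs. M1 d n fs = M2 d n fs} \<le> 1) sequentially"
    by simp
  have "(\<lambda>n. real n powr (- 1 / 8)) \<longlonglongrightarrow> 0" "(\<lambda>n. real n powr (- 1 / 32)) \<longlonglongrightarrow> 0"
    "(\<lambda>n. 1 / real n) \<longlonglongrightarrow> 0" by real_asymp+
  hence "(\<lambda>n. 1 - 3 * real n powr (- 1 / 8) - exp 1 * real d ^ d * real n powr (- 1 / 32)
      - exp 1 * real d ^ 3 * (1 / real n)) \<longlonglongrightarrow> 1 - 3 * 0 - exp 1 * real d ^ d * 0 - exp 1 * real d ^ 3 * 0"
    by (intro tendsto_intros)
  thus "(\<lambda>n. 1 - 3 * real n powr (- 1 / 8) - exp 1 * real d ^ d * real n powr (- 1 / 32)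
      - exp 1 * real d ^ 3 / real n) \<longlonglongrightarrow> 1"
    by simp
qed simp

end
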